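(* Assume that $\lambda\in P$ satisfies $W\lambda\cap(P^+\cup -P^+)=\emptyset$. The crystal graph of $\mathbb{B}(\lambda)$ is connected if and only if $W\lambda$ contains an integral weight $\lambda'$ of the form $\lambda'=k'\Lambda_1-l'\Lambda_2$ with $k',l'\in\mathbb{Z}$ and $|k'|=1$ or $|l'|=1$. Otherwise, the crystal graph of $\mathbb{B}(\lambda)$ has infinitely many connected components.
   Context: Let $a,b\in\mathbb{Z}_{\ge 2}$ with $ab>4$, let $A=\begin{pmatrix}2&-a\\-b&2\end{pmatrix}$, and let $\mathfrak{g}=\mathfrak{g}(A)$ be the hyperbolic Kac-Moody algebra of rank $2$ over $\mathbb{C}$ associated to $A$, with $I=\{1,2\}$, simple roots $\alpha_i$, simple coroots $\alpha_i^\vee$, and fundamental weights $\Lambda_i$ ($\langle\Lambda_i,\alpha_j^\vee\rangle=\delta_{i,j}$). Set $P=\mathbb{Z}\Lambda_1\oplus\mathbb{Z}\Lambda_2$; then $\alpha_1=2\Lambda_1-b\Lambda_2$, $\alpha_2=-a\Lambda_1+2\Lambda_2$. The Weyl group $W=\langle r_1,r_2\rangle$ acts on $P$ by $r_i(\mu)=\mu-\langle\mu,\alpha_i^\vee\rangle\alpha_i$. $P^+=\mathbb{Z}_{\ge0}\Lambda_1+\mathbb{Z}_{\ge0}\Lambda_2$. For a positive real root $\beta$, $\beta^\vee$ is its dual root and $r_\beta\in W$ the reflection in $\beta$. LS paths. Fix $\lambda\in P$. For $\mu,\nu\in W\lambda$ write $\mu\ge\nu$ if there are $\mu=\mu_0,\mu_1,\dots,\mu_u=\nu$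 in $W\lambda$ and positive real roots $\beta_1,\dots,\beta_u$ with $\mu_k=r_{\beta_k}(\mu_{k-1})$ and $\langle\mu_{k-1},\beta_k^\vee\rangle<0$ for all $k$; then $\mathrm{dist}(\mu,\nu)$ is the maximal length $u$ of such sequences. For $\mu>\nu$ and rational $0<\sigma<1$, a $\sigma$-chain for $(\mu,\nu)$ is a sequence $\mu=\mu_0,\dots,\mu_u=\nu$ in $W\lambda$ such that, for all $k$, $\mathrm{dist}(\mu_{k-1},\mu_k)=1$ and $\sigma\langle\mu_{k-1},\beta_k^\vee\rangle\in\mathbb{Z}_{<0}$, where $\beta_k$ is the unique positive real root with $\mu_k=r_{\beta_k}(\mu_{k-1})$. An LS path of shape $\lambda$ is a pair $\pi=(\mu_1,\dots,\mu_u;\sigma_0,\dots,\sigma_u)$ with $\mu_1>\cdots>\mu_u$ in $W\lambda$ and rationals $0=\sigma_0<\cdots<\sigma_u=1$ such that there is a $\sigma_k$-chain for $(\mu_k,\mu_{k+1})$ for each $1\le k\le u-1$. $\mathbb{B}(\lambda)$ is the set of LS paths of shape $\lambda$. $\pi$ is identified with the piecewise-linear map $\pi:[0,1]\to\mathbb{R}\otimes_{\mathbb{Z}}P$, $\pi(t)=\sum_{k=1}^{j-1}(\sigma_k-\sigma_{k-1})\mu_k+(t-\sigma_{j-1})\mu_j$ for $\sigma_{j-1}\le t\le\sigma_j$. Root operators. Let $H_i^\pi(t)=\langle\pi(t),\alpha_i^\vee\rangle$ and $m_i^\pi=\min_{t\in[0,1]}H_i^\pi(t)$ (a nonpositive integer).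 If $m_i^\pi=0$, $\tilde e_i\pi:=\mathbf{0}$ (an extra element). Otherwise let $t_1=\min\{t\mid H_i^\pi(t)=m_i^\pi\}$, $t_0=\max\{t\in[0,t_1]\mid H_i^\pi(t)=m_i^\pi+1\}$, and $(\tilde e_i\pi)(t)=\pi(t)$ on $[0,t_0]$, $r_i(\pi(t)-\pi(t_0))+\pi(t_0)$ on $[t_0,t_1]$, $\pi(t)+\alpha_i$ on $[t_1,1]$. If $H_i^\pi(1)=m_i^\pi$, $\tilde f_i\pi:=\mathbf{0}$. Otherwise let $t_0=\max\{t\mid H_i^\pi(t)=m_i^\pi\}$, $t_1=\min\{t\in[t_0,1]\mid H_i^\pi(t)=m_i^\pi+1\}$, and $(\tilde f_i\pi)(t)=\pi(t)$ on $[0,t_0]$, $r_i(\pi(t)-\pi(t_0))+\pi(t_0)$ on $[t_0,t_1]$, $\pi(t)-\alpha_i$ on $[t_1,1]$. These operators map $\mathbb{B}(\lambda)$ to $\mathbb{B}(\lambda)\cup\{\mathbf{0}\}$. The crystal graph of $\mathbb{B}(\lambda)$ has vertex set $\mathbb{B}(\lambda)$ and an edge $\pi\xrightarrow{i}\tilde f_i\pi$ whenever $\tilde f_i\pi\ne\mathbf{0}$; connectedness is that of the underlying undirected graph. *)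

theory Defs
  imports
    "HOL-Analysis.Product_Vector"
    "HOL-Library.Extended_Nat"
    "HOL-Library.FuncSet"
    "Graph_Theory.Graph_Theory"
begin

section \<open>Weights, roots and the Weyl group\<close>

datatype idx = I1 | I2

text \<open>
  A pair \<open>(k, l)\<close> stands for the weight \<open>k \<Lambda>\<^sub>1 + l \<Lambda>\<^sub>2\<close>, and a pair \<open>(c, d)\<close> of coroot coordinates
  for \<open>c \<alpha>\<^sub>1\<^sup>\<or> + d \<alpha>\<^sub>2\<^sup>\<or>\<close>. The integer instances of the polymorphic definitions below concern \<open>P\<close> and
  the coroot lattice, the real ones \<open>\<real> \<otimes> P\<close>.
  As \<open>det A = 4 - a b \<noteq> 0\<close>, the root lattice embeds into \<open>P\<close>, so roots are written in the basis of
  fundamental weights too.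
\<close>

type_synonym weight = "int \<times> int"
type_synonym coroot = "int \<times> int"

definition pairing :: "'a \<times> 'a \<Rightarrow> 'a \<times> 'a \<Rightarrow> 'a::comm_ring_1" where
  "pairing \<mu> h = fst \<mu> * fst h + snd \<mu> * snd h"

definition smult2 :: "'a \<Rightarrow> 'a \<times> 'a \<Rightarrow> 'a \<times> 'a::comm_ring_1" where
  "smult2 c v = (c * fst v, c * snd v)"

fun simple_root :: "int \<Rightarrow> int \<Rightarrow> idx \<Rightarrow> 'a \<times> 'a::comm_ring_1" where
  "simple_root a b I1 = (2, - of_int b)"
| "simple_root a b I2 = (- of_int a, 2)"

fun simple_coroot :: "idx \<Rightarrow> 'a \<times> 'a::comm_ring_1" where
  "simple_coroot I1 = (1, 0)"
| "simple_coroot I2 = (0, 1)"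

definition simple_refl :: "int \<Rightarrow> int \<Rightarrow> idx \<Rightarrow> 'a \<times> 'a \<Rightarrow> 'a \<times> 'a::comm_ring_1" where
  "simple_refl a b i \<mu> = \<mu> - smult2 (pairing \<mu> (simple_coroot i)) (simple_root a b i)"

text \<open>The contragredient action of the generators on coroots.\<close>

definition simple_corefl :: "int \<Rightarrow> int \<Rightarrow> idx \<Rightarrow> coroot \<Rightarrow> coroot" where
  "simple_corefl a b i h = h - smult2 (pairing (simple_root a b i) h) (simple_coroot i)"

text \<open>
  The generators are involutions, so every element of \<open>W\<close> is a product of a word in them. Words
  serve to let the same element of \<open>W\<close> act on weights and on coroots.
\<close>

definition weyl_act :: "int \<Rightarrow> int \<Rightarrow> idx list \<Rightarrow> weight \<Rightarrow> weight" where
  "weyl_act a b w = foldr (simple_refl a b) w"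

definition weyl_coact :: "int \<Rightarrow> int \<Rightarrow> idx list \<Rightarrow> coroot \<Rightarrow> coroot" where
  "weyl_coact a b w = foldr (simple_corefl a b) w"

definition weyl_group :: "int \<Rightarrow> int \<Rightarrow> (weight \<Rightarrow> weight) set" where
  "weyl_group a b = range (weyl_act a b)"

definition weyl_orbit :: "int \<Rightarrow> int \<Rightarrow> weight \<Rightarrow> weight set" where
  "weyl_orbit a b \<mu> = (\<lambda>w. w \<mu>) ` weyl_group a b"

definition dominant_weights :: "weight set" where
  "dominant_weights = {(k, l). k \<ge> 0 \<and> l \<ge> 0}"

definition real_roots :: "int \<Rightarrow> int \<Rightarrow> weight set" where
  "real_roots a b = {w (simple_root a b i) |w i. w \<in> weyl_group a b}"

definition pos_real_roots :: "int \<Rightarrow> int \<Rightarrow> weight set" where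
  "pos_real_roots a b =
     {\<beta> \<in> real_roots a b. \<exists>c\<ge>0. \<exists>d\<ge>0.
        \<beta> = smult2 c (simple_root a b I1) + smult2 d (simple_root a b I2)}"

text \<open>The dual root of \<open>\<beta> = w \<alpha>\<^sub>i\<close> is \<open>w \<alpha>\<^sub>i\<^sup>\<or>\<close>, which does not depend on the choice of \<open>w\<close> and \<open>i\<close>.\<close>

definition dual_root :: "int \<Rightarrow> int \<Rightarrow> weight \<Rightarrow> coroot" where
  "dual_root a b \<beta> = (THE h. \<exists>w i. \<beta> = weyl_act a b w (simple_root a b i) \<and>
                                  h = weyl_coact a b w (simple_coroot i))"

definition root_refl :: "int \<Rightarrow> int \<Rightarrow> weight \<Rightarrow> weight \<Rightarrow> weight" where
  "root_refl a b \<beta> \<mu> = \<mu> - smult2 (pairing \<mu> (dual_root a b \<beta>)) \<beta>"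


section \<open>Lakshmibai--Seshadri paths\<close>

definition orbit_step :: "int \<Rightarrow> int \<Rightarrow> weight \<Rightarrow> (weight \<times> weight) set" where
  "orbit_step a b lam =
     {(\<mu>, \<nu>). \<mu> \<in> weyl_orbit a b lam \<and> \<nu> \<in> weyl_orbit a b lam \<and>
        (\<exists>\<beta> \<in> pos_real_roots a b. \<nu> = root_refl a b \<beta> \<mu> \<and> pairing \<mu> (dual_root a b \<beta>) < 0)}"

definition orbit_ge :: "int \<Rightarrow> int \<Rightarrow> weight \<Rightarrow> weight \<Rightarrow> weight \<Rightarrow> bool" where
  "orbit_ge a b lam \<mu> \<nu> \<longleftrightarrow>
     \<mu> \<in> weyl_orbit a b lam \<and> \<nu> \<in> weyl_orbit a b lam \<and> (\<mu>, \<nu>) \<in> (orbit_step a b lam)\<^sup>*"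

definition orbit_gt :: "int \<Rightarrow> int \<Rightarrow> weight \<Rightarrow> weight \<Rightarrow> weight \<Rightarrow> bool" where
  "orbit_gt a b lam \<mu> \<nu> \<longleftrightarrow> orbit_ge a b lam \<mu> \<nu> \<and> \<mu> \<noteq> \<nu>"

text \<open>
  The lengths are bounded (each step adds a positive multiple of a positive root), so for \<open>\<mu> \<ge> \<nu>\<close>
  the supremum is a maximum. For incomparable weights it is \<open>0\<close>; in particular distance \<open>1\<close>
  implies \<open>\<mu> > \<nu>\<close>.
\<close>

definition orbit_dist :: "int \<Rightarrow> int \<Rightarrow> weight \<Rightarrow> weight \<Rightarrow> weight \<Rightarrow> enat" where
  "orbit_dist a b lam \<mu> \<nu> = Sup {enat u |u. (\<mu>, \<nu>) \<in> orbit_step a b lam ^^ u}"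

definition sigma_chain :: "int \<Rightarrow> int \<Rightarrow> weight \<Rightarrow> rat \<Rightarrow> weight \<Rightarrow> weight \<Rightarrow> bool" where
  "sigma_chain a b lam \<sigma> \<mu> \<nu> \<longleftrightarrow>
     (\<exists>ms. ms \<noteq> [] \<and> hd ms = \<mu> \<and> last ms = \<nu> \<and> set ms \<subseteq> weyl_orbit a b lam \<and>
       (\<forall>k. Suc k < length ms \<longrightarrow>
          orbit_dist a b lam (ms ! k) (ms ! Suc k) = 1 \<and>
          (\<exists>\<beta> \<in> pos_real_roots a b. ms ! Suc k = root_refl a b \<beta> (ms ! k) \<and>
             \<sigma> * of_int (pairing (ms ! k) (dual_root a b \<beta>)) \<in> \<int> \<and>
             \<sigma> * of_int (pairing (ms ! k) (dual_root a b \<beta>)) < 0)))"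

text \<open>
  In \<open>(\<mu>\<^sub>1, \<dots>, \<mu>\<^sub>u; \<sigma>\<^sub>0, \<dots>, \<sigma>\<^sub>u)\<close> the weights are indexed from 1, but the list \<open>ms\<close> from 0: the entry
  \<open>ms ! k\<close> is \<open>\<mu>\<^sub>k\<^sub>+\<^sub>1\<close>, whereas \<open>ss ! k\<close> is \<open>\<sigma>\<^sub>k\<close>.
\<close>

definition is_LS_path :: "int \<Rightarrow> int \<Rightarrow> weight \<Rightarrow> weight list \<times> rat list \<Rightarrow> bool" where
  "is_LS_path a b lam = (\<lambda>(ms, ss).
     ms \<noteq> [] \<and> length ss = Suc (length ms) \<and> set ms \<subseteq> weyl_orbit a b lam \<and>
     hd ss = 0 \<and> last ss = 1 \<and> sorted_wrt (<) ss \<and>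
     (\<forall>k. Suc k < length ms \<longrightarrow>
        orbit_gt a b lam (ms ! k) (ms ! Suc k) \<and>
        sigma_chain a b lam (ss ! Suc k) (ms ! k) (ms ! Suc k)))"

definition real_weight :: "weight \<Rightarrow> real \<times> real" where
  "real_weight \<mu> = (real_of_int (fst \<mu>), real_of_int (snd \<mu>))"

text \<open>
  Maps on \<open>[0, 1]\<close> are total functions with value \<^const>\<open>undefined\<close> outside, so that equality of
  functions is equality of maps on \<open>[0, 1]\<close>.
\<close>

type_synonym path = "real \<Rightarrow> real \<times> real"

definition path_map :: "weight list \<times> rat list \<Rightarrow> path" where
  "path_map = (\<lambda>(ms, ss). restrict (\<lambda>t.
     let j = (LEAST j. t \<le> of_rat (ss ! Suc j)) in
       (\<Sum>k<j. of_rat (ss ! Suc k - ss ! k) *\<^sub>R real_weight (ms ! k))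
       + (t - of_rat (ss ! j)) *\<^sub>R real_weight (ms ! j)) {0..1})"

text \<open>
  An LS path is determined by its map, because consecutive weights of it are distinct.
\<close>

definition LS_paths :: "int \<Rightarrow> int \<Rightarrow> weight \<Rightarrow> path set" where
  "LS_paths a b lam = path_map ` {p. is_LS_path a b lam p}"


section \<open>Root operators and the crystal graph\<close>

definition height :: "idx \<Rightarrow> path \<Rightarrow> real \<Rightarrow> real" where
  "height i \<pi> t = pairing (\<pi> t) (simple_coroot i)"

definition min_height :: "idx \<Rightarrow> path \<Rightarrow> real" where
  "min_height i \<pi> = (LEAST x. x \<in> height i \<pi> ` {0..1})"

text \<open>\<^const>\<open>None\<close> is the extra element \<open>\<zero>\<close>.\<close>

definition f_op :: "int \<Rightarrow> int \<Rightarrow> idx \<Rightarrow> path \<Rightarrow> path option" where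
  "f_op a b i \<pi> =
     (let m = min_height i \<pi> in
      if height i \<pi> 1 = m then None
      else
        let t0 = (GREATEST t. t \<in> {0..1} \<and> height i \<pi> t = m);
            t1 = (LEAST t. t \<in> {t0..1} \<and> height i \<pi> t = m + 1)
        in Some (restrict (\<lambda>t.
             if t \<le> t0 then \<pi> t
             else if t \<le> t1 then simple_refl a b i (\<pi> t - \<pi> t0) + \<pi> t0
             else \<pi> t - simple_root a b i) {0..1}))"

text \<open>
  The root operators preserve \<open>\<bbbB>(\<lambda>) \<union> {\<zero>}\<close>, so asking for the target to be in \<open>\<bbbB>(\<lambda>)\<close> loses no arc;
  it makes the graph well-formed by definition.
\<close>

definition crystal_graph :: "int \<Rightarrow> int \<Rightarrow> weight \<Rightarrow> (path, path \<times> idx \<times> path) pre_digraph" where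
  "crystal_graph a b lam =
     \<lparr> verts = LS_paths a b lam,
       arcs = {(\<pi>, i, \<pi>'). \<pi> \<in> LS_paths a b lam \<and> \<pi>' \<in> LS_paths a b lam \<and> f_op a b i \<pi> = Some \<pi>'},
       tail = (\<lambda>(\<pi>, i, \<pi>'). \<pi>),
       head = (\<lambda>(\<pi>, i, \<pi>'). \<pi>') \<rparr>"

text \<open>
  Vertex sets of the connected components of the underlying undirected graph: in a symmetric
  digraph they are the strong components.
\<close>

definition connected_components :: "('v, 'e) pre_digraph \<Rightarrow> 'v set set" where
  "connected_components G = pre_digraph.sccs_verts (with_proj (mk_symmetric G))"

end

theory Submission
  imports Defs
begin

text \<open>
  The orbit is a two-sided chain. As no weight of it is dominant or antidominant, both coordinates
  of each of its weights are nonzero and have opposite signs, and every simple reflection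
  exchanges the two sign patterns. So \<open>W\<lambda>\<close> consists of weights \<open>x\<^sub>n\<close> (\<open>n \<in> \<int>\<close>) with
  \<open>x\<^sub>n\<^sub>+\<^sub>1 = r\<^sub>i x\<^sub>n = x\<^sub>n - p\<^sub>n \<alpha>\<^sub>i\<close>, where \<open>i\<close> alternates with the parity of \<open>n\<close> and \<open>p\<^sub>n > 0\<close>. The
  coordinates of \<open>x\<^sub>n\<close> are \<open>p\<^sub>n\<close> and \<open>p\<^sub>n\<^sub>-\<^sub>1\<close> up to order and sign, and \<open>p\<^sub>n\<^sub>+\<^sub>1 + p\<^sub>n\<^sub>-\<^sub>1\<close> equals \<open>b p\<^sub>n\<close> or
  \<open>a p\<^sub>n\<close> according to the parity of \<open>n\<close>. Thus the criterion of the theorem is that some \<open>p\<^sub>n\<close> is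
  \<open>1\<close>.

  The order on the orbit is linear: \<open>x\<^sub>m > x\<^sub>n\<close> iff \<open>m > n\<close>, and distance one means neighbouring
  indices. An LS path therefore walks down the chain; let \<open>s\<^sub>n\<close> be the time at which it passes from
  indices above \<open>n\<close> to indices at most \<open>n\<close>. Existence of the \<open>\<sigma>\<close>-chains says precisely that
  \<open>d\<^sub>n = s\<^sub>n p\<^sub>n\<close> is an integer. In this way LS paths correspond to the sequences \<open>d\<close> with
  \<open>0 \<le> d\<^sub>n \<le> p\<^sub>n\<close>, with \<open>d\<^sub>n / p\<^sub>n\<close> nonincreasing, vanishing far to the right and equal to \<open>p\<close> far to
  the left (\<open>LS_paths_eq\<close>, \<open>turning_path_inj\<close>). The height function for \<open>i\<close> turns from falling to
  rising at the times \<open>s\<^sub>n\<close> with \<open>n\<close> of the parity of \<open>i\<close>. Its values there satisfy a difference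
  equation, and the operator \<open>f\<^sub>i\<close> adds \<open>1\<close> to \<open>d\<^sub>j\<close> for the smallest such index \<open>j\<close> with minimal
  height (\<open>f_op_acts\<close>, \<open>f_op_Some\<close>). The rest of the argument concerns integer sequences.

  If \<open>p\<^sub>m = 1\<close>, then \<open>d\<^sub>m\<close> is \<open>0\<close> or \<open>1\<close>. An entry \<open>d\<^sub>m = 0\<close> forces all later entries to vanish, and it
  can be raised only after all earlier ones have become full. So raising entries must lead to a
  straight path after finitely many steps (\<open>raise_to_straight\<close>); for \<open>d\<^sub>m = 1\<close> the mirror image of
  this argument applies. As all straight paths that occur are connected, so is the graph.

  If all \<open>p\<^sub>n\<close> are at least \<open>2\<close>, then \<open>p = c + c'\<close> for two positive integer solutions of the
  same recurrence (\<open>positive_solution_splits\<close>). Suppose that \<open>d\<close> agrees with \<open>c\<close> on \<open>2r\<close> consecutive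
  indices, that \<open>d / c\<close> is nonincreasing to the right of the start of this window, and that
  \<open>(d - c) / c'\<close> is nonincreasing to the left of its end. Within the window the heights of each
  parity are constant, because \<open>c\<close> solves the recurrence; so no operator can act in its interior,
  and an action at its boundary just moves the window by one place (\<open>locked_f\<close>). Hence the
  existence of such a window is an invariant of the connected component (\<open>locked_crystal_step\<close>).
  Since for every \<open>r\<close> there is a path with a window of length \<open>2r\<close> but with no longer one, there are
  infinitely many components.
\<close>


section \<open>Integer sequences with a three-term recurrence\<close>

definition solution :: "(int \<Rightarrow> int) \<Rightarrow> (int \<Rightarrow> int) \<Rightarrow> bool" where
  "solution k u \<longleftrightarrow> (\<forall>n. u (n + 1) + u (n - 1) = k n * u n)"

lemma solution_next: "solution k u \<Longrightarrow> u (n + 1) = k n * u n - u (n - 1)"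
  unfolding solution_def by (metis add_diff_cancel_right')

lemma solution_prev: "solution k u \<Longrightarrow> u (n - 1) = k n * u n - u (n + 1)"
  unfolding solution_def by (metis add_diff_cancel_left')

lemma solution_diff:
  "solution k u \<Longrightarrow> solution k v \<Longrightarrow> solution k (\<lambda>n. u n - v n)"
  unfolding solution_def by (simp add: algebra_simps)

text \<open>
  The coefficient with index \<open>n\<close> produces the value with index \<open>n + 2\<close>.
\<close>

fun iterate_recurrence :: "(nat \<Rightarrow> int) \<Rightarrow> int \<Rightarrow> int \<Rightarrow> nat \<Rightarrow> int" where
  "iterate_recurrence k x y 0 = x"
| "iterate_recurrence k x y (Suc 0) = y"
| "iterate_recurrence k x y (Suc (Suc n)) =
     k n * iterate_recurrence k x y (Suc n) - iterate_recurrence k x y n"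

text \<open>
  The recurrence can be run in both directions, so two neighbouring values determine a solution and
  may be prescribed freely.
\<close>

lemma solution_exists:
  fixes k :: "int \<Rightarrow> int"
  obtains u where "solution k u" "u m = x" "u (m + 1) = y"
proof -
  define F where "F = iterate_recurrence (\<lambda>n. k (m + 1 + int n)) x y"
  define B where "B = iterate_recurrence (\<lambda>n. k (m - int n)) y x"
  define u where "u n = (if n \<ge> m then F (nat (n - m)) else B (nat (m + 1 - n)))" for n
  have up: "u (m + int i) = F i" for i
    by (simp add: u_def)
  have down: "u (m + 1 - int i) = B i" for i
    by (cases i) (auto simp: u_def F_def B_def nat_add_distrib)
  have "u (n + 1) + u (n - 1) = k n * u n" for n
  proof (cases "n \<ge> m + 1")
    case True
    define i where "i = nat (n - (m + 1))"
    have n: "n = m + 1 + int i"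
      using True by (simp add: i_def)
    show ?thesis
      using up[of "Suc (Suc i)"] up[of "Suc i"] up[of i]
      by (simp add: n F_def algebra_simps)
  next
    case False
    define i where "i = nat (m - n)"
    have n: "n = m - int i"
      using False by (simp add: i_def)
    show ?thesis
      using down[of "Suc (Suc i)"] down[of "Suc i"] down[of i]
      by (simp add: n B_def algebra_simps)
  qed
  then have "solution k u"
    by (simp add: solution_def)
  moreover have "u m = x" "u (m + 1) = y"
    using up[of 0] up[of 1] by (auto simp: F_def)
  ultimately show ?thesis
    using that by blast
qed

text \<open>
  The discrete Wronskian. Its constancy means that the quotient of two positive solutions is
  monotone over all of \<open>\<int>\<close> as soon as it is so at one place.
\<close>

lemma wronskian_const:
  assumes "solution k u" "solution k v"
  shows "u n * v (n + 1) - u (n + 1) * v n = u 0 * v 1 - u 1 * v 0"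
proof -
  have step: "u n * v (n + 1) - u (n + 1) * v n = u (n - 1) * v n - u n * v (n - 1)" for n
    unfolding solution_next[OF assms(1), of n] solution_next[OF assms(2), of n]
    by (simp add: algebra_simps)
  show ?thesis
  proof (induction n rule: int_induct[where k = 0])
    case base
    then show ?case by simp
  next
    case (step1 i)
    then show ?case using step[of "i + 1"] by simp
  next
    case (step2 i)
    then show ?case using step[of i] by simp
  qed
qed

text \<open>
  As \<open>k n \<ge> 2\<close>, a solution is convex wherever it is positive, so from a positive local minimum it
  can only grow in both directions.
\<close>

lemma solution_pos_from_minimum:
  assumes k: "\<And>n. k n \<ge> (2::int)" and u: "solution k u"
    and "0 < u m" "u m \<le> u (m + 1)" "u m \<le> u (m - 1)"
  shows "0 < u n"
proof -
  have convex: "u (n + 1) - u n \<ge> u n - u (n - 1)" if "0 < u n" for n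
    using solution_next[OF u, of n] mult_right_mono[OF k[of n], of "u n"] that by auto
  have up: "0 < u (m + int i) \<and> u (m + int i) \<le> u (m + int i + 1)" for i
  proof (induction i)
    case 0
    then show ?case using assms by simp
  next
    case (Suc i)
    then show ?case
      using convex[of "m + int i + 1"] by (auto simp: algebra_simps)
  qed
  have down: "0 < u (m - int i) \<and> u (m - int i) \<le> u (m - int i - 1)" for i
  proof (induction i)
    case 0
    then show ?case using assms by simp
  next
    case (Suc i)
    then show ?case
      using convex[of "m - int i - 1"] by (auto simp: algebra_simps)
  qed
  show ?thesis
    using up[of "nat (n - m)"] down[of "nat (m - n)"] by (cases "n \<ge> m") auto
qed

text \<open>
  Let \<open>p m\<close> be the minimum of \<open>p\<close>. By the preceding lemma it suffices to choose \<open>c m = 1\<close> and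
  \<open>c (m + 1)\<close> such that \<open>m\<close> is a local minimum both of \<open>c\<close> and of \<open>p - c\<close>. The first condition says
  that \<open>1 \<le> c (m + 1) \<le> k m - 1\<close>, the second is an analogous pair of bounds, and \<open>p m \<ge> 2\<close> makes the
  two intervals meet.
\<close>

lemma positive_solution_splits:
  assumes k: "\<And>n. k n \<ge> (2::int)" and p: "solution k p" and p2: "\<And>n. p n \<ge> 2"
  obtains c where "solution k c" "\<And>n. 0 < c n" "\<And>n. c n < p n"
proof -
  obtain m where m: "p m \<le> p n" for n
  proof -
    obtain m where "\<And>n. nat (p m) \<le> nat (p n)"
      using ex_has_least_nat[of "\<lambda>_. True" undefined "\<lambda>n. nat (p n)"] by auto
    then show ?thesis
      using that[of m] p2 by (smt (verit) nat_le_eq_zle)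
  qed
  define x where "x = p m"
  define y where "y = p (m + 1)"
  define K where "K = k m"
  \<comment> \<open>the least value allowed by the lower bounds; the upper bounds are then verified\<close>
  define t where "t = max 1 (y - (K - 1) * x + (K - 1))"
  have prev: "p (m - 1) = K * x - y"
    using solution_prev[OF p, of m] by (simp add: x_def y_def K_def)
  have xy: "2 \<le> x" "x \<le> y" "x \<le> K * x - y" "2 \<le> K"
    using p2[of m] m[of "m + 1"] m[of "m - 1"] prev k[of m] by (auto simp: x_def y_def K_def)
  have t: "1 \<le> t" "t \<le> K - 1" "t \<le> y - x + 1" "y - t \<le> (K - 1) * (x - 1)"
  proof -
    have "(K - 2) * 1 \<le> (K - 2) * x"
      using xy by (intro mult_left_mono) auto
    then show "1 \<le> t" "t \<le> K - 1" "t \<le> y - x + 1" "y - t \<le> (K - 1) * (x - 1)"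
      using xy by (auto simp: t_def max_def algebra_simps)
  qed
  obtain c where c: "solution k c" "c m = 1" "c (m + 1) = t"
    using solution_exists by blast
  define q where "q n = p n - c n" for n
  have q: "solution k q"
    using solution_diff[OF p c(1)] by (simp add: q_def[abs_def])
  have "c (m - 1) = K - t"
    using solution_prev[OF c(1), of m] c by (simp add: K_def)
  then have "0 < c n" for n
    using solution_pos_from_minimum[OF k c(1), of m] c t by auto
  moreover have "0 < q n" for n
  proof (rule solution_pos_from_minimum[OF k q, of m])
    have qm: "q m = x - 1" "q (m + 1) = y - t"
      using c by (auto simp: q_def x_def y_def)
    then show "0 < q m" "q m \<le> q (m + 1)"
      using xy t by auto
    show "q m \<le> q (m - 1)"
      using solution_prev[OF q, of m] qm t by (simp add: K_def algebra_simps)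
  qed
  ultimately show ?thesis
    using that[OF c(1)] by (auto simp: q_def)
qed


section \<open>Turning sequences and the rule for raising an entry\<close>

text \<open>
  The combinatorial form of an LS path: \<open>d n / p n\<close> is the time at which the path leaves the part of
  the orbit chain with indices above \<open>n\<close>. The last two conditions express that a path visits only
  finitely many weights.
\<close>

definition turning_sequence :: "(int \<Rightarrow> int) \<Rightarrow> (int \<Rightarrow> int) \<Rightarrow> bool" where
  "turning_sequence p d \<longleftrightarrow>
     (\<forall>n. 0 \<le> d n \<and> d n \<le> p n) \<and> (\<forall>n. d (n + 1) * p n \<le> d n * p (n + 1)) \<and>
     (\<exists>N. \<forall>n\<ge>N. d n = 0) \<and> (\<exists>N. \<forall>n\<le>N. d n = p n)"

text \<open>
  \<open>h n\<close> is the height of the path at the time \<open>d n / p n\<close>, with respect to the simple coroot that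
  belongs to the parity of \<open>n\<close>. The defining equation determines \<open>h\<close> up to a constant for each
  parity, and only comparisons within one parity matter.
\<close>

definition min_heights :: "(int \<Rightarrow> int) \<Rightarrow> (int \<Rightarrow> int) \<Rightarrow> (int \<Rightarrow> int) \<Rightarrow> bool" where
  "min_heights k d h \<longleftrightarrow> (\<forall>n. h n - h (n + 2) = k (n + 1) * d (n + 1) - d n - d (n + 2))"

text \<open>
  The rule of the root operator: among the indices of the parity of \<open>j\<close>, the minimal height is
  attained at \<open>j\<close>, and \<open>j\<close> is the smallest such index. A path visits large indices first, so \<open>j\<close>
  stands for the last time at which the minimum is attained.
\<close>

definition f_acts_at :: "(int \<Rightarrow> int) \<Rightarrow> (int \<Rightarrow> int) \<Rightarrow> int \<Rightarrow> bool" where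
  "f_acts_at k d j \<longleftrightarrow> (\<exists>h. min_heights k d h \<and>
     (\<forall>l>j. even (l - j) \<longrightarrow> h j \<le> h l) \<and> (\<forall>l<j. even (l - j) \<longrightarrow> h j < h l))"

text \<open>
  The corresponding rule of the inverse operator, which takes the first time of the minimum.
\<close>

definition e_acts_at :: "(int \<Rightarrow> int) \<Rightarrow> (int \<Rightarrow> int) \<Rightarrow> int \<Rightarrow> bool" where
  "e_acts_at k d j \<longleftrightarrow> (\<exists>h. min_heights k d h \<and>
     (\<forall>l>j. even (l - j) \<longrightarrow> h j < h l) \<and> (\<forall>l<j. even (l - j) \<longrightarrow> h j \<le> h l))"

lemma min_heights_below:
  "min_heights k d h \<Longrightarrow> h (j - 2) - h j = k (j - 1) * d (j - 1) - d (j - 2) - d j"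
  unfolding min_heights_def by (drule spec[of _ "j - 2"]) simp

lemma min_heights_above:
  "min_heights k d h \<Longrightarrow> h j - h (j + 2) = k (j + 1) * d (j + 1) - d j - d (j + 2)"
  unfolding min_heights_def by simp

text \<open>
  Raising entry \<open>j\<close> lowers the heights of its parity by \<open>1\<close> at \<open>j\<close> and by \<open>2\<close> at all later times, that
  is at smaller indices. This turns the weak inequality at larger indices into a strict one and the
  strict one at smaller indices into a weak one.
\<close>

lemma f_acts_at_imp_e_acts_at:
  assumes "f_acts_at k d j"
  shows "e_acts_at k (d(j := d j + 1)) j"
proof -
  obtain h where h: "min_heights k d h"
    "\<forall>l>j. even (l - j) \<longrightarrow> h j \<le> h l" "\<forall>l<j. even (l - j) \<longrightarrow> h j < h l"
    using assms by (auto simp: f_acts_at_def)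
  \<comment> \<open>heights of the other parity change by the off-diagonal coefficient at all later times\<close>
  define g where "g l = (if even (l - j) then h l - (if l > j then 0 else if l = j then 1 else 2)
      else h l + (if l < j then k j else 0))" for l
  show ?thesis
    unfolding e_acts_at_def
  proof (intro exI conjI)
    show "min_heights k (d(j := d j + 1)) g"
      unfolding min_heights_def
    proof
      fix n
      have "n = j \<or> n = j - 1 \<or> n = j - 2 \<or> n + 2 < j \<or> j < n" by auto
      moreover have "h n - h (n + 2) = k (n + 1) * d (n + 1) - d n - d (n + 2)"
        using h(1) by (simp add: min_heights_def)
      ultimately show "g n - g (n + 2) = k (n + 1) * (d(j := d j + 1)) (n + 1)
          - (d(j := d j + 1)) n - (d(j := d j + 1)) (n + 2)"
        by (auto simp: g_def algebra_simps)
    qed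
  qed (use h in \<open>force simp: g_def\<close>)+
qed

text \<open>
  If entry \<open>j\<close> is raised by \<open>1\<close>, then its ratio to any positive solution \<open>u\<close> stays below that of its
  left neighbour: the recurrence for \<open>u\<close> matches the equation for the heights, and the drop of the
  height from \<open>j - 2\<close> to \<open>j\<close> leaves room for one unit. The lemma is used for \<open>u = p\<close>, where it says that
  LS paths are sent to LS paths, and for the two summands of \<open>p\<close>.
\<close>

lemma ratio_after_f:
  fixes u g h k :: "int \<Rightarrow> int"
  assumes u: "solution k u" "\<And>n. 0 < u n" and h: "min_heights k g h" "h j < h (j - 2)"
    and ratio: "g (j - 1) * u (j - 2) \<le> g (j - 2) * u (j - 1)"
  shows "(g j + 1) * u (j - 1) \<le> g (j - 1) * u j"
proof -
  have "g j + 1 \<le> k (j - 1) * g (j - 1) - g (j - 2)"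
    using min_heights_below[OF h(1), of j] h(2) by simp
  then have "(g j + 1) * u (j - 1) \<le> (k (j - 1) * g (j - 1) - g (j - 2)) * u (j - 1)"
    using u(2)[of "j - 1"] by (intro mult_right_mono) auto
  also have "\<dots> \<le> k (j - 1) * g (j - 1) * u (j - 1) - g (j - 1) * u (j - 2)"
    using ratio by (simp add: algebra_simps)
  also have "\<dots> = g (j - 1) * (k (j - 1) * u (j - 1) - u (j - 2))"
    by (simp add: algebra_simps)
  also have "\<dots> = g (j - 1) * u j"
    using solution_next[OF u(1), of "j - 1"] by simp
  finally show ?thesis .
qed

lemma turning_sequence_f:
  assumes p: "solution k p" "\<And>n. 0 < p n" and d: "turning_sequence p d" and f: "f_acts_at k d j"
  shows "turning_sequence p (d(j := d j + 1))"
proof -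
  obtain h where h: "min_heights k d h" "h j < h (j - 2)"
    using f by (force simp: f_acts_at_def)
  have mono: "d (n + 1) * p n \<le> d n * p (n + 1)" and bd: "0 \<le> d n" "d n \<le> p n" for n
    using d by (auto simp: turning_sequence_def)
  obtain N1 N2 where N: "\<forall>n\<ge>N1. d n = 0" "\<forall>n\<le>N2. d n = p n"
    using d by (auto simp: turning_sequence_def)
  have le: "(d j + 1) * p (j - 1) \<le> d (j - 1) * p j"
    using ratio_after_f[OF p h] mono[of "j - 2"] by simp
  have "d (j - 1) * p j \<le> p (j - 1) * p j"
    using bd[of "j - 1"] p(2)[of j] by (intro mult_right_mono) auto
  then have "(d j + 1) * p (j - 1) \<le> p j * p (j - 1)"
    using le by (simp add: algebra_simps)
  then have "d j + 1 \<le> p j"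
    using p(2)[of "j - 1"] by simp
  moreover have "d (j + 1) * p j \<le> (d j + 1) * p (j + 1)"
    using mono[of j] p(2)[of "j + 1"] by (simp add: algebra_simps)
  moreover have "\<forall>n\<ge>max N1 (j + 1). (d(j := d j + 1)) n = 0" "\<forall>n\<le>min N2 (j - 1). (d(j := d j + 1)) n = p n"
    using N by auto
  ultimately show ?thesis
    unfolding turning_sequence_def using bd mono le
    by (intro conjI allI exI[of _ "max N1 (j + 1)"] exI[of _ "min N2 (j - 1)"])
       (auto simp: add_increasing2)
qed

text \<open>
  The sequence of the path that consists of the single weight with index \<open>m\<close>.
\<close>

definition straight :: "(int \<Rightarrow> int) \<Rightarrow> int \<Rightarrow> int \<Rightarrow> int" where
  "straight p m n = (if n < m then p n else 0)"

lemma turning_sequence_zero_above: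
  assumes p: "\<And>n. 0 < p n" and d: "turning_sequence p d" and "d m = 0" "m \<le> n"
  shows "d n = 0"
  using \<open>m \<le> n\<close>
proof (induction n rule: int_ge_induct)
  case (step i)
  have "d (i + 1) * p i \<le> d i * p (i + 1)" "0 \<le> d (i + 1)"
    using d by (auto simp: turning_sequence_def)
  then show ?case
    using step p[of i] by (simp add: mult_le_0_iff)
qed (use assms in auto)

lemma turning_sequence_full_below:
  assumes p: "\<And>n. 0 < p n" and d: "turning_sequence p d" and "d m = p m" "n \<le> m"
  shows "d n = p n"
  using \<open>n \<le> m\<close>
proof (induction n rule: int_le_induct)
  case (step i)
  have "d i * p (i - 1) \<le> d (i - 1) * p i" "d (i - 1) \<le> p (i - 1)"
    using d unfolding turning_sequence_def by (metis diff_add_cancel)+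
  then show ?case
    using step p[of i] by (simp add: mult.commute)
qed (use assms in auto)

text \<open>
  An explicit solution of the equation for the heights: the actual heights of the path, which starts
  at \<open>0\<close>, if \<open>d\<close> vanishes from \<open>M\<close> on.
\<close>

definition bottom :: "(int \<Rightarrow> int) \<Rightarrow> (int \<Rightarrow> int) \<Rightarrow> int \<Rightarrow> int \<Rightarrow> int" where
  "bottom k d M n = - d n + (\<Sum>j\<in>{n<..<M}. d j * (if even (j - n) then - 2 else k j))"

lemma min_heights_bottom:
  assumes "\<forall>n\<ge>M. d n = 0"
  shows "min_heights k d (bottom k d M)"
  unfolding min_heights_def
proof
  fix n
  show "bottom k d M n - bottom k d M (n + 2) = k (n + 1) * d (n + 1) - d n - d (n + 2)"
  proof (cases "n + 2 < M")
    case True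
    then have "{n<..<M} = insert (n + 1) (insert (n + 2) {n + 2<..<M})"
      by auto
    then show ?thesis
      by (simp add: bottom_def)
  next
    case False
    then have "{n<..<M} = (if n + 1 < M then {n + 1} else {})" "{n + 2<..<M} = {}" "d (n + 2) = 0"
      using assms by auto
    then show ?thesis
      using assms by (auto simp: bottom_def)
  qed
qed

lemma bottom_above: "\<forall>n\<ge>M. d n = 0 \<Longrightarrow> n \<ge> M \<Longrightarrow> bottom k d M n = 0"
  by (simp add: bottom_def)

lemma bottom_indep: "\<forall>n\<ge>M. d n = 0 \<Longrightarrow> M \<le> M' \<Longrightarrow> bottom k d M' n = bottom k d M n"
  unfolding bottom_def
  by (rule arg_cong[where f = "\<lambda>x. - d n + x"], rule sum.mono_neutral_right) auto

lemma min_heights_eq: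
  assumes "min_heights k d h" "min_heights k d g"
  shows "h (n + 2 * int i) - h n = g (n + 2 * int i) - g n"
proof (induction i)
  case (Suc i)
  then show ?case
    using min_heights_above[OF assms(1), of "n + 2 * int i"] min_heights_above[OF assms(2), of "n + 2 * int i"]
    by (simp add: algebra_simps)
qed simp

lemma f_acts_at_bottom:
  assumes f: "f_acts_at k d j" and "\<forall>n\<ge>M. d n = 0" and "even (l - j)"
  shows "j < l \<Longrightarrow> bottom k d M j \<le> bottom k d M l" "l < j \<Longrightarrow> bottom k d M j < bottom k d M l"
proof -
  obtain h where h: "min_heights k d h" "\<forall>l>j. even (l - j) \<longrightarrow> h j \<le> h l" "\<forall>l<j. even (l - j) \<longrightarrow> h j < h l"
    using f by (auto simp: f_acts_at_def)
  have same: "h n - h m = bottom k d M n - bottom k d M m" if "m \<le> n" "even (n - m)" for m n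
    using min_heights_eq[OF h(1) min_heights_bottom[OF assms(2)], of m "nat ((n - m) div 2)"] that
    by simp
  show "bottom k d M j \<le> bottom k d M l" if "j < l"
  proof -
    have "h j \<le> h l"
      using h(2) that assms(3) by blast
    then show ?thesis
      using same[of j l] that assms(3) by simp
  qed
  show "bottom k d M j < bottom k d M l" if "l < j"
  proof -
    have "h j < h l" "even (j - l)"
      using h(3) that assms(3) by (blast, presburger)
    then show ?thesis
      using same[of l j] that by simp
  qed
qed

definition crystal_step where
  "crystal_step k p d d' \<longleftrightarrow> turning_sequence p d \<and> turning_sequence p d' \<and>
     (\<exists>j. f_acts_at k d j \<and> d' = d(j := d j + 1))"

text \<open>
  The reversed path in the opposite direction of the chain. The mirror exchanges the two kinds of
  root operators, so that each statement about lowering entries follows from one about raising them.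
\<close>

definition mirror :: "(int \<Rightarrow> int) \<Rightarrow> (int \<Rightarrow> int) \<Rightarrow> int \<Rightarrow> int" where
  "mirror p d n = p (- n) - d (- n)"

lemma mirror_mirror: "mirror (\<lambda>n. p (- n)) (mirror p d) = d"
  by (auto simp: mirror_def)

lemma solution_mirror: "solution k u \<Longrightarrow> solution (\<lambda>n. k (- n)) (\<lambda>n. u (- n))"
  using solution_next[of k u "- n" for n] by (simp add: solution_def)

lemma min_heights_mirror:
  assumes "solution k p" "min_heights k d h"
  shows "min_heights (\<lambda>n. k (- n)) (mirror p d) (\<lambda>n. h (- n))"
  unfolding min_heights_def
proof
  fix n :: int
  define x where "x = - n"
  have x: "- n = x" "- (n + 1) = x - 1" "- (n + 2) = x - 2"
    by (auto simp: x_def)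
  have "h (x - 2) - h x = k (x - 1) * d (x - 1) - d (x - 2) - d x"
    by (rule min_heights_below[OF assms(2)])
  moreover have "p x + p (x - 2) = k (x - 1) * p (x - 1)"
    using solution_next[OF assms(1), of "x - 1"] by simp
  ultimately show "h (- n) - h (- (n + 2)) = k (- (n + 1)) * mirror p d (n + 1) - mirror p d n - mirror p d (n + 2)"
    unfolding mirror_def x by (simp add: algebra_simps)
qed

lemma e_acts_at_mirror:
  assumes "solution k p" "e_acts_at k d j"
  shows "f_acts_at (\<lambda>n. k (- n)) (mirror p d) (- j)"
proof -
  obtain h where h: "min_heights k d h"
    "\<And>l. l > j \<Longrightarrow> even (l - j) \<Longrightarrow> h j < h l" "\<And>l. l < j \<Longrightarrow> even (l - j) \<Longrightarrow> h j \<le> h l"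
    using assms(2) unfolding e_acts_at_def by blast
  show ?thesis
    unfolding f_acts_at_def
    by (intro exI[of _ "\<lambda>n. h (- n)"] conjI min_heights_mirror[OF assms(1) h(1)])
       (auto intro!: h)
qed

lemma turning_sequence_mirror:
  assumes "turning_sequence p d"
  shows "turning_sequence (\<lambda>n. p (- n)) (mirror p d)"
proof -
  obtain N1 N2 where N: "\<forall>n\<ge>N1. d n = 0" "\<forall>n\<le>N2. d n = p n"
    using assms by (auto simp: turning_sequence_def)
  have mono: "d (- n) * p (- (n + 1)) \<le> d (- (n + 1)) * p (- n)" for n
    using assms unfolding turning_sequence_def by (auto dest: spec[of _ "- (n + 1)"])
  have "\<forall>n\<ge>- N2. mirror p d n = 0" "\<forall>n\<le>- N1. mirror p d n = p (- n)"
    using N by (auto simp: mirror_def)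
  moreover have "mirror p d (n + 1) * p (- n) \<le> mirror p d n * p (- (n + 1))" for n
    using mono[of n] by (simp add: mirror_def algebra_simps)
  ultimately show ?thesis
    using assms unfolding turning_sequence_def by (auto simp: mirror_def)
qed

lemma crystal_step_mirror:
  assumes p: "solution k p" and "crystal_step k p d d'"
  shows "crystal_step (\<lambda>n. k (- n)) (\<lambda>n. p (- n)) (mirror p d') (mirror p d)"
proof -
  obtain j where j: "f_acts_at k d j" "d' = d(j := d j + 1)"
    and t: "turning_sequence p d" "turning_sequence p d'"
    using assms(2) by (auto simp: crystal_step_def)
  have "f_acts_at (\<lambda>n. k (- n)) (mirror p d') (- j)"
    using e_acts_at_mirror[OF p f_acts_at_imp_e_acts_at[OF j(1)]] j(2) by simp
  moreover have "mirror p d = (mirror p d')(- j := mirror p d' (- j) + 1)"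
    using j(2) by (auto simp: mirror_def)
  ultimately show ?thesis
    using t turning_sequence_mirror unfolding crystal_step_def by blast
qed


section \<open>Connectedness when the solution takes the value one\<close>

text \<open>
  Constancy far out on both sides leaves only finitely many indices to compare. The value below the
  one on the far left is what makes a smallest minimising index exist.
\<close>

lemma first_minimum:
  fixes h :: "int \<Rightarrow> int"
  assumes up: "\<And>l. l \<ge> M \<Longrightarrow> even (l - i) \<Longrightarrow> h l = v"
    and low: "\<And>l. l < N \<Longrightarrow> even (l - i) \<Longrightarrow> h l = w"
    and below: "h n < w" "even (n - i)"
  shows "\<exists>j. even (j - i) \<and> (\<forall>l>j. even (l - j) \<longrightarrow> h j \<le> h l) \<and>
    (\<forall>l<j. even (l - j) \<longrightarrow> h j < h l)"
proof -
  define lo where "lo = min N n"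
  define hi where "hi = max M n + 1"
  define A where "A = {l \<in> {lo..hi}. even (l - i)}"
  have fin: "finite A"
    by (rule finite_subset[of _ "{lo..hi}"]) (auto simp: A_def)
  have nA: "n \<in> A"
    using below by (auto simp: A_def lo_def hi_def)
  define m where "m = Min (h ` A)"
  have m: "m \<le> h l" if "l \<in> A" for l
    using that fin by (simp add: m_def)
  have mA: "m \<in> h ` A"
    unfolding m_def using fin nA by (intro Min_in) auto
  define j where "j = Min {l \<in> A. h l = m}"
  have "j \<in> {l \<in> A. h l = m}"
    unfolding j_def using fin mA by (intro Min_in) auto
  then have j: "j \<in> A" "h j = m"
    by auto
  have jmin: "j \<le> l" if "l \<in> A" "h l = m" for l
    using that fin by (simp add: j_def)
  have all: "m \<le> h l \<and> (l < j \<longrightarrow> m < h l)" if "even (l - i)" for l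
  proof -
    have "l \<in> A \<or> l < lo \<or> l > hi"
      using that by (auto simp: A_def)
    then consider "l \<in> A" | "l < lo" | "l > hi"
      by blast
    then show ?thesis
    proof cases
      case 1
      then show ?thesis using m[of l] jmin[of l] by force
    next
      case 2
      then show ?thesis using low[of l] that below m[OF nA] by (auto simp: lo_def)
    next
      case 3
      define l' where "l' = (if even (max M n - i) then max M n else max M n + 1)"
      have l': "l' \<in> A" "l' \<ge> M" "even (l' - i)"
        by (auto simp: l'_def A_def lo_def hi_def)
      then show ?thesis using 3 up[of l] up[of l'] that m[of l'] j by (auto simp: A_def hi_def)
    qed
  qed
  have ji: "even (j - i)"
    using j by (auto simp: A_def)
  have "even (l - i)" if "even (l - j)" for l
    using that ji by presburger
  then show ?thesis
    using all j(2) ji by (intro exI[of _ j]) blast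
qed

text \<open>
  Left of the first entry \<open>n\<close> that is not full the heights are constant, because \<open>p\<close> solves the
  recurrence, and at \<open>n\<close> the height is smaller by \<open>p n - d n\<close>. So the minimum is not approached on the far left.
\<close>

lemma some_f_acts:
  assumes p: "solution k p" and d: "turning_sequence p d" and n: "d n < p n" "\<And>l. l < n \<Longrightarrow> d l = p l"
  obtains j where "f_acts_at k d j"
proof -
  obtain M where M: "\<forall>n\<ge>M. d n = 0"
    using d by (auto simp: turning_sequence_def)
  define h where "h = bottom k d M"
  have h: "min_heights k d h" "\<And>n. n \<ge> M \<Longrightarrow> h n = 0"
    using min_heights_bottom[OF M] bottom_above[OF M] by (simp_all add: h_def)
  have flat: "h (n - 2 - 2 * int i) = h (n - 2)" for i
  proof (induction i)
    case (Suc i)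
    define l where "l = n - 2 - 2 * int i"
    have "h (l - 2) - h l = k (l - 1) * p (l - 1) - p (l - 2) - p l"
      using min_heights_below[OF h(1), of l] n(2) by (simp add: l_def)
    then show ?case
      using Suc solution_next[OF p, of "l - 1"] by (simp add: l_def algebra_simps)
  qed simp
  have low: "h l = h (n - 2)" if "l < n" "even (l - n)" for l
  proof -
    have "l \<le> n - 2"
      using that by presburger
    then have "l = n - 2 - 2 * int (nat ((n - 2 - l) div 2))"
      using that(2) by auto
    then show ?thesis
      using flat[of "nat ((n - 2 - l) div 2)"] by simp
  qed
  have "h (n - 2) - h n = p n - d n"
    using min_heights_below[OF h(1), of n] solution_next[OF p, of "n - 1"] n(2) by simp
  then have "h n < h (n - 2)"
    using n by simp
  have "even (n - n)"
    by simp
  have "\<exists>j. even (j - n) \<and> (\<forall>l>j. even (l - j) \<longrightarrow> h j \<le> h l) \<and> (\<forall>l<j. even (l - j) \<longrightarrow> h j < h l)"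
    by (rule first_minimum[of M n h 0 n "h (n - 2)" n, OF h(2) low \<open>h n < h (n - 2)\<close> \<open>even (n - n)\<close>])
  then show ?thesis
    using that h(1) unfolding f_acts_at_def by blast
qed

text \<open>
  As long as \<open>d m = 0\<close>, all entries beyond \<open>m\<close> vanish as well, and each step raises an entry with
  index at most \<open>m\<close>. The amount missing there is finite, so \<open>m\<close> itself gets raised at some point. At
  that moment \<open>d m\<close> becomes \<open>1 = p m\<close>, which forces all entries below \<open>m\<close> to be full.
\<close>

lemma raise_to_straight:
  assumes p: "solution k p" "\<And>n. 0 < p n" and m: "p m = 1"
    and d: "turning_sequence p d" "d m = 0"
  shows "(crystal_step k p)\<^sup>*\<^sup>* d (straight p (m + 1))"
proof -
  obtain N where N: "\<forall>n\<le>N. d n = p n"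
    using d by (auto simp: turning_sequence_def)
  define N' where "N' = min N m"
  have "\<forall>n<N'. d n = p n"
    using N by (auto simp: N'_def)
  then show ?thesis
    using d
  proof (induction "nat (\<Sum>n\<in>{N'..m}. p n - d n)" arbitrary: d rule: less_induct)
    case less
    have bd: "0 \<le> d n" "d n \<le> p n" for n
      using less.prems by (auto simp: turning_sequence_def)
    obtain n where n: "d n < p n" "\<And>l. l < n \<Longrightarrow> d l = p l"
    proof -
      define i where "i = (LEAST i. d (N' + int i) < p (N' + int i))"
      have ex: "d (N' + int (nat (m - N'))) < p (N' + int (nat (m - N')))"
        using less.prems m by (auto simp: N'_def)
      have i: "d (N' + int i) < p (N' + int i)"
        unfolding i_def
        by (rule LeastI[where P = "\<lambda>i. d (N' + int i) < p (N' + int i)", OF ex])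
      have low: "d l = p l" if "l < N' + int i" for l
      proof (cases "l < N'")
        case False
        then have "nat (l - N') < i"
          using that by simp
        then have "\<not> d (N' + int (nat (l - N'))) < p (N' + int (nat (l - N')))"
          unfolding i_def by (rule not_less_Least)
        then show ?thesis
          using False bd[of l] by simp
      qed (use less.prems in auto)
      show ?thesis
        using that i low by blast
    qed
    obtain j where j: "f_acts_at k d j"
      using some_f_acts[OF p(1) less.prems(2) n] by blast
    define d' where "d' = d(j := d j + 1)"
    have d': "turning_sequence p d'"
      unfolding d'_def by (rule turning_sequence_f[OF p less.prems(2) j])
    have step: "crystal_step k p d d'"
      using less.prems d' j by (auto simp: crystal_step_def d'_def)
    have bd': "0 \<le> d' n" "d' n \<le> p n" for n
      using d' by (auto simp: turning_sequence_def)
    have jm: "j \<le> m"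
    proof (rule ccontr)
      assume *: "\<not> j \<le> m"
      then have "d' m = 0"
        using less.prems(3) by (simp add: d'_def)
      then have "d' j = 0"
        using turning_sequence_zero_above[OF p(2) d', of m j] * by simp
      then show False
        using bd[of j] by (simp add: d'_def)
    qed
    have jN: "N' \<le> j"
    proof (rule ccontr)
      assume "\<not> N' \<le> j"
      then show False
        using bd'[of j] less.prems by (simp add: d'_def)
    qed
    show ?case
    proof (cases "j = m")
      case True
      have "d' n = straight p (m + 1) n" for n
      proof (cases "n \<le> m")
        case True
        then show ?thesis
          using turning_sequence_full_below[OF p(2) d', of m n] \<open>j = m\<close> m less.prems
          by (simp add: d'_def straight_def)
      next
        case False
        then show ?thesis
          using turning_sequence_zero_above[OF p(2) less.prems(2), of m n] \<open>j = m\<close> less.prems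
          by (simp add: d'_def straight_def)
      qed
      then have "d' = straight p (m + 1)"
        by blast
      then show ?thesis
        using step by blast
    next
      case False
      have "(\<Sum>n\<in>{N'..m}. p n - d' n) < (\<Sum>n\<in>{N'..m}. p n - d n)"
        by (rule sum_strict_mono_ex1) (use jm jN in \<open>auto simp: d'_def\<close>)
      moreover have "0 \<le> (\<Sum>n\<in>{N'..m}. p n - d' n)"
        using bd' by (intro sum_nonneg) auto
      ultimately have "nat (\<Sum>n\<in>{N'..m}. p n - d' n) < nat (\<Sum>n\<in>{N'..m}. p n - d n)"
        by simp
      moreover have "\<forall>n<N'. d' n = p n" "d' m = 0"
        using False jN less.prems by (auto simp: d'_def)
      ultimately have "(crystal_step k p)\<^sup>*\<^sup>* d' (straight p (m + 1))"
        using less.hyps d' by blast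
      then show ?thesis
        by (rule converse_rtranclp_into_rtranclp[where r = "crystal_step k p", OF step])
    qed
  qed
qed

lemma turning_sequence_straight:
  assumes "\<And>n. 0 < p n"
  shows "turning_sequence p (straight p m)"
  unfolding turning_sequence_def straight_def
  using assms by (intro conjI allI exI[of _ m] exI[of _ "m - 1"]) (auto simp: less_imp_le)

text \<open>
  Since \<open>p m = 1\<close>, the entry \<open>d m\<close> is \<open>0\<close> or full. In the first case \<open>d\<close> can be raised to the straight
  sequence of index \<open>m + 1\<close>, and so can the straight sequence of index \<open>m\<close>. In the second case the
  mirror image of \<open>d\<close> can be raised, that is, \<open>d\<close> can be lowered to the straight sequence of index \<open>m\<close>.
\<close>

lemma crystal_steps_connected:
  assumes p: "solution k p" "\<And>n. 0 < p n" and m: "p m = 1" and d: "turning_sequence p d"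
  shows "equivclp (crystal_step k p) d (straight p m)"
proof -
  let ?k = "\<lambda>n. k (- n)" and ?p = "\<lambda>n. p (- n)" and ?R = "equivclp (crystal_step k p)"
  have up: "?R e e'" if "(crystal_step k p)\<^sup>*\<^sup>* e e'" for e e'
    using that by (rule rtranclp_into_equivclp)
  have link: "?R (straight p m) (straight p (m + 1))"
    by (rule up, rule raise_to_straight[OF p m turning_sequence_straight])
       (use p in \<open>auto simp: straight_def\<close>)
  have "d m = 0 \<or> d m = 1"
  proof -
    have "0 \<le> d m" "d m \<le> p m"
      using d by (auto simp: turning_sequence_def)
    then show ?thesis
      using m by linarith
  qed
  then show ?thesis
  proof
    assume "d m = 0"
    then have "?R d (straight p (m + 1))"
      using up raise_to_straight[OF p m d] by blast
    then show ?thesis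
      using equivclp_sym[OF link] by (rule equivclp_trans)
  next
    assume 1: "d m = 1"
    have p': "solution ?k ?p" "\<And>n. 0 < ?p n"
      using p solution_mirror by auto
    have "(crystal_step ?k ?p)\<^sup>*\<^sup>* (mirror p d) (straight ?p (- m + 1))"
      by (rule raise_to_straight[OF p' _ turning_sequence_mirror[OF d]])
         (use m 1 in \<open>auto simp: mirror_def\<close>)
    moreover have "(crystal_step k p)\<^sup>*\<^sup>* (mirror ?p e') (mirror ?p e)"
      if "(crystal_step ?k ?p)\<^sup>*\<^sup>* e e'" for e e'
      using that
    proof (induction)
      case (step y z)
      have "crystal_step k p (mirror ?p z) (mirror ?p y)"
        using crystal_step_mirror[OF p'(1) step(2)] by simp
      then show ?case
        using step by (meson converse_rtranclp_into_rtranclp)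
    qed auto
    moreover have "mirror ?p (straight ?p (- m + 1)) = straight p m"
      by (auto simp: mirror_def straight_def)
    ultimately have "(crystal_step k p)\<^sup>*\<^sup>* (straight p m) d"
      using mirror_mirror[of p d] by force
    then show ?thesis
      by (rule equivclp_sym[OF up])
  qed
qed

section \<open>Locked windows: an invariant of the connected components\<close>

text \<open>
  Here \<open>c + c'\<close> is the solution \<open>p\<close> that belongs to the orbit. Right of the start of the window, \<open>d\<close>
  has the monotonicity of a turning sequence for \<open>c\<close>, and left of its end, \<open>d - c\<close> has that of a
  turning sequence for \<open>c'\<close>. These two conditions are what makes the window survive the root operators.
\<close>

definition locked :: "(int \<Rightarrow> int) \<Rightarrow> (int \<Rightarrow> int) \<Rightarrow> nat \<Rightarrow> (int \<Rightarrow> int) \<Rightarrow> bool" where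
  "locked c c' r d \<longleftrightarrow> (\<exists>m.
     (\<forall>n. m \<le> n \<and> n < m + 2 * int r \<longrightarrow> d n = c n) \<and>
     (\<forall>n\<ge>m. d (n + 1) * c n \<le> d n * c (n + 1)) \<and>
     (\<forall>n < m + 2 * int r - 1. (d (n + 1) - c (n + 1)) * c' n \<le> (d n - c n) * c' (n + 1)))"

text \<open>
  Subtracting a solution of the recurrence does not change the heights; so one may compute with
  \<open>d - c\<close>, which vanishes on the window.
\<close>

lemma min_heights_diff_solution:
  assumes "solution k c" "min_heights k d h"
  shows "min_heights k (\<lambda>n. d n - c n) h"
  unfolding min_heights_def
proof
  fix n
  show "h n - h (n + 2) = k (n + 1) * (d (n + 1) - c (n + 1)) - (d n - c n) - (d (n + 2) - c (n + 2))"
    using min_heights_above[OF assms(2), of n] solution_next[OF assms(1), of "n + 1"]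
    by (simp add: algebra_simps)
qed

text \<open>
  On the window \<open>d - c\<close> vanishes, hence the heights of each parity are constant there, and \<open>j\<close>, being
  the smallest index of minimal height, cannot have \<open>j - 2\<close> in the window too. At the second index
  of the window, minimality at \<open>j\<close> would contradict that \<open>d\<close> is at least \<open>c\<close> just left of the window.
  If \<open>j\<close> is the first index, minimality forces \<open>d\<close> to agree with \<open>c\<close> at the first index beyond the
  window, because the length is even and the height at the last index of the right parity ties with
  that at \<open>j\<close>; so the window moves up by one. Outside of the window the monotonicity
  conditions persist by \<open>ratio_after_f\<close>, applied to \<open>c\<close> on the right and to \<open>c'\<close> on the left.
\<close>

lemma locked_f:
  assumes c: "solution k c" "\<And>n. 0 < c n" and c': "solution k c'" "\<And>n. 0 < c' n"
    and r: "0 < r" and lock: "locked c c' r d" and f: "f_acts_at k d j"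
  shows "locked c c' r (d(j := d j + 1))"
proof -
  obtain h where h: "min_heights k d h" "\<And>l. l > j \<Longrightarrow> even (l - j) \<Longrightarrow> h j \<le> h l"
    "\<And>l. l < j \<Longrightarrow> even (l - j) \<Longrightarrow> h j < h l"
    using f unfolding f_acts_at_def by blast
  define L where "L = 2 * int r"
  have L: "2 \<le> L" "even L"
    using r by (auto simp: L_def)
  define g where "g n = d n - c n" for n
  have g: "min_heights k g h"
    unfolding g_def[abs_def] by (rule min_heights_diff_solution[OF c(1) h(1)])
  obtain m where m: "\<And>n. m \<le> n \<Longrightarrow> n < m + L \<Longrightarrow> d n = c n"
    "\<And>n. m \<le> n \<Longrightarrow> d (n + 1) * c n \<le> d n * c (n + 1)"
    "\<And>n. n < m + L - 1 \<Longrightarrow> g (n + 1) * c' n \<le> g n * c' (n + 1)"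
    using lock unfolding locked_def L_def g_def by blast
  have gm: "g n = 0" if "m \<le> n" "n < m + L" for n
    using m(1) that by (simp add: g_def)
  have flat: "h (n - 2) = h n" if "m + 2 \<le> n" "n < m + L" for n
    using min_heights_below[OF g, of n] gm[of n] gm[of "n - 1"] gm[of "n - 2"] that by simp
  have h_j: "h j < h (j - 2)"
    using h(3)[of "j - 2"] by simp
  \<comment> \<open>the monotonicity conditions at the raised entry, on either side of the window\<close>
  have raised_right: "(d j + 1) * c (j - 1) \<le> d (j - 1) * c j" if "m + 2 \<le> j"
    using ratio_after_f[OF c h(1) h_j] m(2)[of "j - 2"] that by simp
  have raised_left: "(g j + 1) * c' (j - 1) \<le> g (j - 1) * c' j" if "j \<le> m"
    using ratio_after_f[OF c' g h_j] m(3)[of "j - 2"] that L by simp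
  define d' where "d' = d(j := d j + 1)"
  have d': "d' n = (if n = j then d j + 1 else d n)" for n
    by (simp add: d'_def)
  have "\<exists>m'. (\<forall>n. m' \<le> n \<and> n < m' + L \<longrightarrow> d' n = c n) \<and>
      (\<forall>n\<ge>m'. d' (n + 1) * c n \<le> d' n * c (n + 1)) \<and>
      (\<forall>n < m' + L - 1. (d' (n + 1) - c (n + 1)) * c' n \<le> (d' n - c n) * c' (n + 1))"
  proof -
    consider "j < m" | "j = m" | "j = m + 1" | "m + 2 \<le> j" "j < m + L" | "m + L \<le> j"
      by linarith
    then show ?thesis
    proof cases
      case 1
      have "(d' (n + 1) - c (n + 1)) * c' n \<le> (d' n - c n) * c' (n + 1)" if "n < m + L - 1" for n
        using m(3)[OF that] raised_left 1 c'(2)[of "n + 1"]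
        by (auto simp: d' g_def algebra_simps)
      then show ?thesis
        using 1 m by (intro exI[of _ m]) (auto simp: d')
    next
      case 2
      have "h (m + 2 * int i) = h m" if "i < r" for i
        using that
      proof (induction i)
        case (Suc i)
        then show ?case
          using flat[of "m + 2 * int (Suc i)"] by (simp add: L_def algebra_simps)
      qed simp
      from this[of "r - 1"] have "h (m + L - 2) = h m"
        using r by (simp add: L_def of_nat_diff algebra_simps)
      moreover have "h (m + L - 2) - h (m + L) = - g (m + L)"
        using min_heights_below[OF g, of "m + L"] gm[of "m + L - 1"] gm[of "m + L - 2"] L by simp
      moreover have "h m \<le> h (m + L)"
        using h(2)[of "m + L"] 2 L by simp
      moreover have "d (m + L) * c (m + L - 1) \<le> c (m + L) * c (m + L - 1)"
        using m(2)[of "m + L - 1"] m(1)[of "m + L - 1"] L by (simp add: mult.commute)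
      then have "d (m + L) \<le> c (m + L)"
        using c(2)[of "m + L - 1"] by simp
      ultimately have end_eq: "d (m + L) = c (m + L)"
        by (simp add: g_def)
      then have wide: "d n = c n" if "m \<le> n" "n \<le> m + L" for n
        using m(1)[of n] that by (cases "n = m + L") auto
      have "(d' (n + 1) - c (n + 1)) * c' n \<le> (d' n - c n) * c' (n + 1)" if "n < m + L" for n
      proof -
        consider "n + 1 < m" | "n + 1 = m" | "n = m" | "m < n" by linarith
        then show ?thesis
        proof cases
          case 1
          then show ?thesis
            using m(3)[of n] 2 L by (simp add: d' g_def)
        next
          case 3
          then show ?thesis
            using wide[of m] wide[of "m + 1"] 2 L c'(2)[of "m + 1"] by (simp add: d' less_imp_le)
        next
          case 4
          then show ?thesis
            using wide[of n] wide[of "n + 1"] 2 that by (simp add: d')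
        qed (use raised_left 2 in \<open>auto simp: d' g_def algebra_simps\<close>)
      qed
      moreover have "d' n = c n" if "m + 1 \<le> n" "n < m + 1 + L" for n
        using wide[of n] that 2 by (simp add: d')
      ultimately show ?thesis
        using 2 m(2) by (intro exI[of _ "m + 1"]) (auto simp: d')
    next
      case 3
      have "0 \<le> g (m - 1) * c' m"
        using m(3)[of "m - 1"] gm[of m] L by simp
      then have "0 \<le> g (m - 1)"
        using c'(2)[of m] by (simp add: zero_le_mult_iff)
      moreover have "h (m - 1) - h (m + 1) = - g (m - 1)"
        using min_heights_below[OF g, of "m + 1"] gm[of m] gm[of "m + 1"] L by simp
      ultimately show ?thesis
        using h_j 3 by simp
    next
      case 4
      then show ?thesis
        using flat[of j] h_j by simp
    next
      case 5
      have "d' (n + 1) * c n \<le> d' n * c (n + 1)" if "m \<le> n" for n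
        using m(2)[OF that] raised_right 5 L c(2)[of "n + 1"]
        by (auto simp: d' algebra_simps)
      then show ?thesis
        using 5 m by (intro exI[of _ m]) (auto simp: d' g_def)
    qed
  qed
  then show ?thesis
    by (simp only: locked_def L_def d'_def)
qed

text \<open>
  The mirror exchanges the roles of the two summands of \<open>p\<close> and of the two sides of the window.
\<close>

lemma locked_mirror:
  assumes "locked c c' r d" and p: "\<And>n. p n = c n + c' n"
  shows "locked (\<lambda>n. c' (- n)) (\<lambda>n. c (- n)) r (mirror p d)"
proof -
  obtain m where m: "\<And>n. m \<le> n \<Longrightarrow> n < m + 2 * int r \<Longrightarrow> d n = c n"
    "\<And>n. m \<le> n \<Longrightarrow> d (n + 1) * c n \<le> d n * c (n + 1)"
    "\<And>n. n < m + 2 * int r - 1 \<Longrightarrow> (d (n + 1) - c (n + 1)) * c' n \<le> (d n - c n) * c' (n + 1)"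
    using assms(1) unfolding locked_def by blast
  define m' where "m' = 1 - (m + 2 * int r)"
  show ?thesis
    unfolding locked_def
  proof (intro exI[of _ m'] conjI allI impI)
    fix n assume "m' \<le> n \<and> n < m' + 2 * int r"
    then show "mirror p d n = c' (- n)"
      using m(1)[of "- n"] by (simp add: m'_def mirror_def p)
  next
    fix n assume "m' \<le> n"
    then show "mirror p d (n + 1) * c' (- n) \<le> mirror p d n * c' (- (n + 1))"
      using m(3)[of "- (n + 1)"] by (simp add: m'_def mirror_def p algebra_simps)
  next
    fix n assume "n < m' + 2 * int r - 1"
    then show "(mirror p d (n + 1) - c' (- (n + 1))) * c (- n)
        \<le> (mirror p d n - c' (- n)) * c (- (n + 1))"
      using m(2)[of "- (n + 1)"] by (simp add: m'_def mirror_def p algebra_simps)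
  qed
qed

lemma locked_crystal_step:
  assumes c: "solution k c" "\<And>n. 0 < c n" and c': "solution k c'" "\<And>n. 0 < c' n"
    and p: "solution k p" "\<And>n. p n = c n + c' n"
    and r: "0 < r" and step: "crystal_step k p d d'"
  shows "locked c c' r d \<longleftrightarrow> locked c c' r d'"
proof
  show "locked c c' r d \<Longrightarrow> locked c c' r d'"
    using locked_f[OF c c' r] step by (auto simp: crystal_step_def)
  assume "locked c c' r d'"
  then have l: "locked (\<lambda>n. c' (- n)) (\<lambda>n. c (- n)) r (mirror p d')"
    using locked_mirror p(2) by blast
  obtain j where "f_acts_at (\<lambda>n. k (- n)) (mirror p d') j"
    "mirror p d = (mirror p d')(j := mirror p d' j + 1)"
    using crystal_step_mirror[OF p(1) step] by (auto simp: crystal_step_def)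
  then have "locked (\<lambda>n. c' (- n)) (\<lambda>n. c (- n)) r (mirror p d)"
    using locked_f[OF solution_mirror[OF c'(1)] c'(2) solution_mirror[OF c(1)] c(2) r l] by simp
  then have "locked (\<lambda>n. c (- (- n))) (\<lambda>n. c' (- (- n))) r (mirror (\<lambda>n. p (- n)) (mirror p d))"
    by (rule locked_mirror) (simp add: p(2))
  then show "locked c c' r d"
    by (simp add: mirror_mirror)
qed

text \<open>
  These sequences, for varying \<open>r\<close>, represent different components if \<open>p\<close> is the sum of \<open>c\<close> and
  another positive solution.
\<close>

definition window_sequence where
  "window_sequence c p r n = (if n < 0 then p n else if n < 2 * int r then c n else (0::int))"

lemma turning_sequence_window:
  assumes c: "\<And>n. 0 < c n" "\<And>n. c n \<le> p n"
    and cp: "\<And>n. c (n + 1) * p n \<le> c n * p (n + 1)"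
  shows "turning_sequence p (window_sequence c p r)"
proof -
  have p: "0 < p n" for n
    using c[of n] by simp
  have "window_sequence c p r (n + 1) * p n \<le> window_sequence c p r n * p (n + 1)" for n
    using cp[of n] p[of n] p[of "n + 1"] c(1)[of n] c(2)[of "n + 1"]
    by (auto simp: window_sequence_def mult.commute[of "p n"] intro!: mult_right_mono)
  moreover have "\<forall>n\<ge>2 * int r. window_sequence c p r n = 0" "\<forall>n\<le>- 1. window_sequence c p r n = p n"
    by (auto simp: window_sequence_def)
  moreover have "0 \<le> window_sequence c p r n \<and> window_sequence c p r n \<le> p n" for n
    using c[of n] by (auto simp: window_sequence_def less_imp_le)
  ultimately show ?thesis
    unfolding turning_sequence_def by blast
qed

lemma locked_window:
  assumes c: "\<And>n. 0 < c n" and c': "\<And>n. 0 < c' n" and p: "\<And>n. p n = c n + c' n"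
  shows "locked c c' r (window_sequence c p r)"
  unfolding locked_def
  by (intro exI[of _ 0]) (use c c' in \<open>auto simp: window_sequence_def p less_imp_le\<close>)

text \<open>
  Both \<open>c\<close> and \<open>c'\<close> are positive, so the sequence agrees with \<open>c\<close> nowhere outside of its window.
\<close>

lemma not_locked_window:
  assumes c: "\<And>n. 0 < c n" and c': "\<And>n. 0 < c' n" and p: "\<And>n. p n = c n + c' n" and "r < r'"
  shows "\<not> locked c c' r' (window_sequence c p r)"
proof
  assume "locked c c' r' (window_sequence c p r)"
  then obtain m where m: "\<And>n. m \<le> n \<Longrightarrow> n < m + 2 * int r' \<Longrightarrow> window_sequence c p r n = c n"
    unfolding locked_def by blast
  have "window_sequence c p r n \<noteq> c n" if "n < 0 \<or> 2 * int r \<le> n" for n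
    using that c[of n] c'[of n] by (auto simp: window_sequence_def p)
  have "0 \<le> n \<and> n < 2 * int r" if "m \<le> n" "n < m + 2 * int r'" for n
    using m[OF that] \<open>\<And>n. n < 0 \<or> 2 * int r \<le> n \<Longrightarrow> window_sequence c p r n \<noteq> c n\<close>[of n] by linarith
  from this[of m] this[of "m + 2 * int r' - 1"] show False
    using \<open>r < r'\<close> by linarith
qed

text \<open>
  By constancy of the Wronskian, one of the two summands has a nonincreasing ratio to \<open>p\<close>; name this
  one \<open>c\<close>.
\<close>

lemma dominating_splitting:
  assumes p: "solution k p" and k: "\<And>n. k n \<ge> 2" and p2: "\<And>n. p n \<ge> 2"
  obtains c c' where "solution k c" "solution k c'" "\<And>n. 0 < c n" "\<And>n. 0 < c' n"
    "\<And>n. p n = c n + c' n" "\<And>n. c (n + 1) * p n \<le> c n * p (n + 1)"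
proof -
  obtain c where c: "solution k c" "\<And>n. 0 < c n" "\<And>n. c n < p n"
    using positive_solution_splits[OF k p p2] by blast
  define c' where "c' n = p n - c n" for n
  have c': "solution k c'" "\<And>n. 0 < c' n" "\<And>n. p n = c n + c' n"
    using solution_diff[OF p c(1)] c(3) by (auto simp: c'_def[abs_def])
  show ?thesis
  proof (cases "0 \<le> c 0 * p 1 - c 1 * p 0")
    case True
    then have "c (n + 1) * p n \<le> c n * p (n + 1)" for n
      using wronskian_const[OF c(1) p, of n] by simp
    then show ?thesis
      using that c c' by blast
  next
    case False
    then have "c' (n + 1) * p n \<le> c' n * p (n + 1)" for n
      using wronskian_const[OF c(1) p, of n] by (simp add: c'_def algebra_simps)
    then show ?thesis
      using that[of c' c] c c' by (simp add: add.commute)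
  qed
qed

section \<open>The Weyl orbit\<close>

text \<open>
  The coefficients of the recurrence of the orbit: minus the off-diagonal entries of \<open>A\<close>, alternating.
\<close>

definition coef :: "int \<Rightarrow> int \<Rightarrow> int \<Rightarrow> int" where
  "coef a b n = (if even n then b else a)"

text \<open>
  The simple reflection that leads from the orbit weight with index \<open>n\<close> to the next one.
\<close>

definition letter :: "int \<Rightarrow> idx" where
  "letter n = (if even n then I1 else I2)"

text \<open>
  The weight with index \<open>n\<close> pairs to \<open>p n\<close> with the coroot of \<open>letter n\<close> and to \<open>- p (n - 1)\<close> with the
  other simple coroot, since it arises from its predecessor by the reflection \<open>letter (n - 1)\<close>.
\<close>

definition chain_weight :: "(int \<Rightarrow> int) \<Rightarrow> int \<Rightarrow> weight" where
  "chain_weight p n = (if even n then (p n, - p (n - 1)) else (- p (n - 1), p n))"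

lemmas weight_defs = simple_refl_def smult2_def pairing_def simple_corefl_def

lemma chain_weight_up:
  assumes "solution (coef a b) p"
  shows "simple_refl a b (letter n) (chain_weight p n) = chain_weight p (n + 1)"
  using solution_next[OF assms, of n]
  by (auto simp: weight_defs letter_def chain_weight_def coef_def)

lemma chain_weight_down:
  assumes "solution (coef a b) p"
  shows "simple_refl a b (letter n) (chain_weight p (n + 1)) = chain_weight p n"
  using solution_prev[OF assms, of n]
  by (auto simp: weight_defs letter_def chain_weight_def coef_def)

lemma chain_weight_step:
  assumes "solution (coef a b) p"
  shows "chain_weight p n = chain_weight p (n + 1) + smult2 (p n) (simple_root a b (letter n))"
  using solution_prev[OF assms, of n]
  by (auto simp: weight_defs letter_def chain_weight_def coef_def)

lemma weyl_act_Nil [simp]: "weyl_act a b [] = id"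
  and weyl_act_Cons [simp]: "weyl_act a b (i # w) v = simple_refl a b i (weyl_act a b w v)"
  and weyl_coact_Nil [simp]: "weyl_coact a b [] = id"
  and weyl_coact_Cons [simp]: "weyl_coact a b (i # w) h = simple_corefl a b i (weyl_coact a b w h)"
  by (simp_all add: weyl_act_def weyl_coact_def)

lemma weyl_orbit_conv: "weyl_orbit a b lam = range (\<lambda>w. weyl_act a b w lam)"
  by (auto simp: weyl_orbit_def weyl_group_def)

lemma simple_refl_orbit:
  "v \<in> weyl_orbit a b lam \<Longrightarrow> simple_refl a b i v \<in> weyl_orbit a b lam"
proof -
  assume "v \<in> weyl_orbit a b lam"
  then obtain w where "v = weyl_act a b w lam"
    by (auto simp: weyl_orbit_conv)
  then have "simple_refl a b i v = weyl_act a b (i # w) lam"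
    by simp
  then show ?thesis
    unfolding weyl_orbit_conv by blast
qed

lemma letter_cases:
  obtains "i = letter n" | "i = letter (n - 1)"
  by (cases i; cases "even n") (auto simp: letter_def)

lemma weyl_orbit_chain:
  assumes p: "solution (coef a b) p" and lam: "lam = chain_weight p m"
  shows "weyl_orbit a b lam = range (chain_weight p)"
proof
  have "weyl_act a b w lam \<in> range (chain_weight p)" for w
  proof (induction w)
    case (Cons i w)
    then obtain n where n: "weyl_act a b w lam = chain_weight p n"
      by blast
    show ?case
      using letter_cases[of i n]
    proof cases
      case 1
      then show ?thesis using chain_weight_up[OF p, of n] n by simp
    next
      case 2
      then show ?thesis using chain_weight_down[OF p, of "n - 1"] n by simp
    qed
  qed (simp add: lam)
  then show "weyl_orbit a b lam \<subseteq> range (chain_weight p)"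
    by (auto simp: weyl_orbit_conv)
  have "chain_weight p n \<in> weyl_orbit a b lam" for n
  proof (induction n rule: int_induct[where k = m])
    case base
    show ?case
      unfolding weyl_orbit_conv lam by (rule range_eqI[of _ _ "[]"]) simp
  next
    case (step1 i)
    then show ?case
      using simple_refl_orbit[OF step1(2), of "letter i"] chain_weight_up[OF p, of i] by simp
  next
    case (step2 i)
    then show ?case
      using simple_refl_orbit[OF step2(2), of "letter (i - 1)"] chain_weight_down[OF p, of "i - 1"] by simp
  qed
  then show "range (chain_weight p) \<subseteq> weyl_orbit a b lam"
    by blast
qed

text \<open>
  Starting from \<open>lam\<close>, or from its predecessor in the chain if its first coordinate is negative, the
  recurrence parametrises the orbit by a solution \<open>p\<close> with \<open>p 0 > 0\<close>. That the coordinates of each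
  weight have opposite signs means that neighbouring values of \<open>p\<close> have the same sign.
\<close>

lemma orbit_is_positive_chain:
  assumes "weyl_orbit a b lam \<inter> (dominant_weights \<union> uminus ` dominant_weights) = {}"
  obtains p where "solution (coef a b) p" "\<And>n. 0 < p n"
    "weyl_orbit a b lam = range (chain_weight p)"
proof -
  have mixed: "(0 < fst v \<and> snd v < 0) \<or> (fst v < 0 \<and> 0 < snd v)" if "v \<in> weyl_orbit a b lam" for v
  proof -
    have "v \<notin> dominant_weights" "- v \<notin> dominant_weights"
      using assms that by (auto simp: image_iff) (metis IntI UnI2 assms empty_iff imageI minus_minus)
    then show ?thesis
      by (cases v) (auto simp: dominant_weights_def)
  qed
  have "lam \<in> weyl_orbit a b lam"
    unfolding weyl_orbit_conv by (rule range_eqI[of _ _ "[]"]) simp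
  then have lam: "(0 < fst lam \<and> snd lam < 0) \<or> (fst lam < 0 \<and> 0 < snd lam)"
    by (rule mixed)
  obtain p m where p: "solution (coef a b) p" "lam = chain_weight p m" "0 < p 0"
  proof (cases "0 < fst lam")
    case True
    obtain u where "solution (coef a b) u" "u (- 1) = - snd lam" "u (- 1 + 1) = fst lam"
      using solution_exists by blast
    then show ?thesis
      using that[of u 0] True by (simp add: chain_weight_def)
  next
    case False
    obtain u where "solution (coef a b) u" "u 0 = - fst lam" "u (0 + 1) = snd lam"
      using solution_exists by blast
    then show ?thesis
      using that[of u 1] False lam by (simp add: chain_weight_def)
  qed
  have orbit: "weyl_orbit a b lam = range (chain_weight p)"
    by (rule weyl_orbit_chain[OF p(1,2)])
  have same_sign: "0 < p n \<longleftrightarrow> 0 < p (n - 1)" for n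
  proof -
    have "chain_weight p n \<in> weyl_orbit a b lam"
      using orbit by simp
    from mixed[OF this] show ?thesis
      by (cases "even n") (auto simp: chain_weight_def)
  qed
  have "0 < p n" for n
  proof (induction n rule: int_induct[where k = 0])
    case (step1 i)
    then show ?case using same_sign[of "i + 1"] by simp
  next
    case (step2 i)
    then show ?case using same_sign[of i] by simp
  qed (fact p(3))
  then show ?thesis
    using that p orbit by blast
qed


section \<open>Dual roots of simple roots\<close>

text \<open>
  Up to a scalar, the equivariant map from weights to coroots given by the invariant form: it sends
  \<open>\<alpha>\<^sub>1\<close> and \<open>\<alpha>\<^sub>2\<close> to \<open>4 - a b\<close> times \<open>b \<alpha>\<^sub>1\<^sup>\<or>\<close> and \<open>a \<alpha>\<^sub>2\<^sup>\<or>\<close>. The factor avoids denominators.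
\<close>

definition coroot_of :: "int \<Rightarrow> int \<Rightarrow> weight \<Rightarrow> coroot" where
  "coroot_of a b v = (b * (2 * fst v + a * snd v), a * (b * fst v + 2 * snd v))"

lemma coroot_of_weyl_act:
  "coroot_of a b (weyl_act a b w v) = weyl_coact a b w (coroot_of a b v)"
proof (induction w)
  case (Cons i w)
  have "coroot_of a b (simple_refl a b i u) = simple_corefl a b i (coroot_of a b u)" for u
    by (cases i) (auto simp: coroot_of_def weight_defs algebra_simps)
  then show ?case
    using Cons by simp
qed simp

lemma pairing_invariant:
  "pairing (weyl_act a b w v) (weyl_coact a b w h) = pairing v h"
proof (induction w)
  case (Cons i w)
  have "pairing (simple_refl a b i u) (simple_corefl a b i g) = pairing u g" for u g :: "int \<times> int"
    by (cases i) (auto simp: weight_defs algebra_simps)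
  then show ?case
    using Cons by simp
qed simp

lemma weyl_coact_smult2: "weyl_coact a b w (smult2 c h) = smult2 c (weyl_coact a b w h)"
proof (induction w)
  case (Cons i w)
  have "simple_corefl a b i (smult2 c g) = smult2 c (simple_corefl a b i g)" for g
    by (cases i) (auto simp: weight_defs algebra_simps)
  then show ?case
    using Cons by simp
qed simp

text \<open>
  If \<open>\<alpha>\<^sub>i = w \<alpha>\<^sub>j\<close>, then equivariance of \<open>coroot_of\<close> shows that \<open>w \<alpha>\<^sub>j\<^sup>\<or>\<close> is a multiple of \<open>\<alpha>\<^sub>i\<^sup>\<or>\<close>. As
  \<open>w\<close> preserves the pairing, both pair to \<open>2\<close> with \<open>\<alpha>\<^sub>i\<close> and hence they agree.
\<close>

lemma dual_root_simple:
  assumes "a > 0" "b > 0" "a * b > 4"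
  shows "dual_root a b (simple_root a b i) = simple_coroot i"
  unfolding dual_root_def
proof (rule the_equality)
  show "\<exists>w j. simple_root a b i = weyl_act a b w (simple_root a b j) \<and>
      simple_coroot i = weyl_coact a b w (simple_coroot j)"
    by (intro exI[of _ "[]"] exI[of _ i]) simp
next
  fix h
  assume "\<exists>w j. simple_root a b i = weyl_act a b w (simple_root a b j) \<and>
      h = weyl_coact a b w (simple_coroot j)"
  then obtain w j where w: "simple_root a b i = weyl_act a b w (simple_root a b j)"
    and h: "h = weyl_coact a b w (simple_coroot j)"
    by blast
  define m where "m i = (case i of I1 \<Rightarrow> b * (4 - a * b) | I2 \<Rightarrow> a * (4 - a * b))" for i
  have m: "coroot_of a b (simple_root a b i) = smult2 (m i) (simple_coroot i)" for i
    by (cases i) (auto simp: coroot_of_def smult2_def m_def algebra_simps)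
  have "m j \<noteq> 0"
    using assms by (cases j) (auto simp: m_def)
  have scaled: "smult2 (m i) (simple_coroot i) = smult2 (m j) h"
    using m[of i] m[of j] coroot_of_weyl_act[of a b w "simple_root a b j"] weyl_coact_smult2 w h by simp
  have "pairing (simple_root a b i) h = pairing (simple_root a b j) (simple_coroot j :: coroot)"
    unfolding w h by (rule pairing_invariant)
  also have "\<dots> = 2"
    by (cases j) (auto simp: pairing_def)
  finally have "pairing (simple_root a b i) h = 2" .
  then show "h = simple_coroot i"
    using scaled \<open>m j \<noteq> 0\<close>
    by (cases i; cases h) (auto simp: pairing_def smult2_def)
qed

lemma real_root_nonzero:
  assumes "\<beta> \<in> real_roots a b"
  shows "\<beta> \<noteq> 0"
proof -
  obtain w i where \<beta>: "\<beta> = weyl_act a b w (simple_root a b i)"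
    using assms by (auto simp: real_roots_def weyl_group_def)
  have "simple_root a b i \<noteq> (0 :: weight)"
    by (cases i) (auto simp: zero_prod_def)
  moreover have "simple_refl a b j v \<noteq> 0" if "v \<noteq> 0" for j and v :: weight
    using that by (cases j; cases v) (auto simp: weight_defs zero_prod_def)
  then have "weyl_act a b w v \<noteq> 0" if "v \<noteq> 0" for v
    using that by (induction w) auto
  ultimately show ?thesis
    unfolding \<beta> by simp
qed


section \<open>The order on the orbit\<close>

locale weight_chain =
  fixes a b :: int and p :: "int \<Rightarrow> int" and lam :: weight
  assumes a: "a \<ge> 2" and b: "b \<ge> 2" and ab: "a * b > 4"
    and p: "solution (coef a b) p" and p_pos: "\<And>n. 0 < p n"
    and orbit: "weyl_orbit a b lam = range (chain_weight p)"
begin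

text \<open>
  A linear form that is positive on both simple roots, and so increases along every step of the
  orbit order. With \<open>f = a b + 4\<close> and \<open>g = 4 a\<close>, the form \<open>- f v\<^sub>1 - g v\<^sub>2\<close> is positive on them iff
  \<open>f / g\<close> lies between \<open>2 / a\<close> and \<open>b / 2\<close>; here it is the midpoint of these numbers, and
  \<open>a b > 4\<close> says that the interval is not empty.
\<close>

definition level :: "weight \<Rightarrow> int" where
  "level v = - (a * b + 4) * fst v - 4 * a * snd v"

lemma level_simple: "0 < level (simple_root a b i)"
proof (cases i)
  case I1
  then show ?thesis
    using ab by (simp add: level_def algebra_simps)
next
  case I2
  have "level (simple_root a b i) = a * (a * b - 4)"
    by (simp add: I2 level_def algebra_simps)
  then show ?thesis
    using ab a by simp
qed

lemma level_add: "level (u + v) = level u + level v"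
  and level_smult: "level (smult2 c v) = c * level v"
  by (simp_all add: level_def smult2_def algebra_simps)

lemma level_chain: "level (chain_weight p (n + 1)) < level (chain_weight p n)"
  by (subst (2) chain_weight_step[OF p]) (simp add: level_add level_smult p_pos level_simple)

lemma level_chain_less: "m < n \<longleftrightarrow> level (chain_weight p n) < level (chain_weight p m)"
proof -
  have up: "level (chain_weight p n) < level (chain_weight p m)" if "m < n" for m n
    using that
  proof (induction n rule: int_gr_induct)
    case base
    then show ?case by (rule level_chain)
  next
    case (step i)
    then show ?case using level_chain[of i] by simp
  qed
  show ?thesis
    using up[of m n] up[of n m] by (cases m n rule: linorder_cases) auto
qed

lemma chain_weight_inj: "chain_weight p m = chain_weight p n \<longleftrightarrow> m = n"
  using level_chain_less[of m n] level_chain_less[of n m] by (cases m n rule: linorder_cases) auto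

lemma level_orbit_step:
  assumes "(\<mu>, \<nu>) \<in> orbit_step a b lam"
  shows "level \<mu> < level \<nu>"
proof -
  obtain \<beta> where \<beta>: "\<beta> \<in> pos_real_roots a b" "\<nu> = root_refl a b \<beta> \<mu>"
    "pairing \<mu> (dual_root a b \<beta>) < 0"
    using assms by (auto simp: orbit_step_def)
  obtain c d where cd: "0 \<le> c" "0 \<le> d"
    "\<beta> = smult2 c (simple_root a b I1) + smult2 d (simple_root a b I2)" and "\<beta> \<noteq> 0"
    using \<beta>(1) real_root_nonzero[of \<beta> a b] unfolding pos_real_roots_def by blast
  then have "0 < c \<or> 0 < d"
    by (auto simp: smult2_def zero_prod_def)
  then have "0 < level \<beta>"
    using cd level_simple[of I1] level_simple[of I2] unfolding cd(3) level_add level_smult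
    by (smt (verit) mult_nonneg_nonneg mult_pos_pos)
  then have "pairing \<mu> (dual_root a b \<beta>) * level \<beta> < 0"
    using \<beta>(3) by (rule mult_neg_pos[rotated])
  moreover have "level \<nu> = level \<mu> - pairing \<mu> (dual_root a b \<beta>) * level \<beta>"
    unfolding \<beta>(2) root_refl_def by (simp add: level_def smult2_def algebra_simps)
  ultimately show ?thesis
    by simp
qed

lemma root_refl_simple: "root_refl a b (simple_root a b i) v = simple_refl a b i v"
  using a b ab by (simp add: root_refl_def simple_refl_def dual_root_simple)

lemma simple_root_pos: "simple_root a b i \<in> pos_real_roots a b"
proof -
  have "simple_root a b i = id (simple_root a b i)"
    by simp
  moreover have "id \<in> weyl_group a b"
    unfolding weyl_group_def by (rule range_eqI[of _ _ "[]"]) simp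
  ultimately have "simple_root a b i \<in> real_roots a b"
    unfolding real_roots_def by blast
  moreover have "\<exists>c\<ge>0. \<exists>d\<ge>0. simple_root a b i =
      smult2 c (simple_root a b I1) + smult2 d (simple_root a b I2 :: weight)"
  proof (cases i)
    case I1
    then show ?thesis
      by (intro exI[of _ 1] conjI exI[of _ 0]) (auto simp: smult2_def)
  next
    case I2
    then show ?thesis
      by (intro exI[of _ 0] conjI exI[of _ 1]) (auto simp: smult2_def)
  qed
  ultimately show ?thesis
    by (simp add: pos_real_roots_def)
qed

lemma pairing_chain: "pairing (chain_weight p (n + 1)) (simple_coroot (letter n)) = - p n"
  by (auto simp: pairing_def chain_weight_def letter_def)

lemma chain_orbit_step: "(chain_weight p (n + 1), chain_weight p n) \<in> orbit_step a b lam"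
proof -
  have "chain_weight p n = root_refl a b (simple_root a b (letter n)) (chain_weight p (n + 1))"
    using chain_weight_down[OF p] by (simp add: root_refl_simple)
  moreover have "pairing (chain_weight p (n + 1)) (dual_root a b (simple_root a b (letter n))) < 0"
    using a b ab p_pos by (simp add: dual_root_simple pairing_chain)
  ultimately show ?thesis
    unfolding orbit_step_def using orbit simple_root_pos by blast
qed

text \<open>
  Each step strictly increases the level, hence strictly decreases the index. So a sequence of
  steps is longest if it consists of steps to neighbours.
\<close>

lemma orbit_steps_bound:
  assumes "(chain_weight p m, chain_weight p n) \<in> orbit_step a b lam ^^ u"
  shows "n + int u \<le> m"
  using assms
proof (induction u arbitrary: n)
  case 0
  then show ?case
    by (simp add: chain_weight_inj)
next
  case (Suc u)
  obtain \<kappa> where \<kappa>: "(chain_weight p m, \<kappa>) \<in> orbit_step a b lam ^^ u"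
    "(\<kappa>, chain_weight p n) \<in> orbit_step a b lam"
    using Suc.prems by auto
  then obtain j where j: "\<kappa> = chain_weight p j"
    using orbit by (auto simp: orbit_step_def)
  have "n < j"
    using level_orbit_step[OF \<kappa>(2)] level_chain_less j by simp
  then show ?case
    using Suc.IH[of j] \<kappa>(1) j by simp
qed

lemma chain_orbit_steps: "(chain_weight p (n + int u), chain_weight p n) \<in> orbit_step a b lam ^^ u"
proof (induction u)
  case (Suc u)
  have "(chain_weight p (n + int (Suc u)), chain_weight p (n + int u)) \<in> orbit_step a b lam"
    using chain_orbit_step[of "n + int u"] by (simp add: algebra_simps)
  then show ?case
    using Suc by (rule relpow_Suc_I2)
qed simp

lemma orbit_dist_chain:
  "orbit_dist a b lam (chain_weight p m) (chain_weight p n) = enat (nat (m - n))"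
proof (cases "n \<le> m")
  case True
  have "(chain_weight p m, chain_weight p n) \<in> orbit_step a b lam ^^ nat (m - n)"
    using chain_orbit_steps[of n "nat (m - n)"] True by simp
  moreover have "u \<le> nat (m - n)" if "(chain_weight p m, chain_weight p n) \<in> orbit_step a b lam ^^ u" for u
    using orbit_steps_bound[OF that] by simp
  ultimately show ?thesis
    unfolding orbit_dist_def by (intro antisym Sup_least Sup_upper) auto
next
  case False
  then have "(chain_weight p m, chain_weight p n) \<notin> orbit_step a b lam ^^ u" for u
    using orbit_steps_bound[of m n u] by auto
  then show ?thesis
    using False unfolding orbit_dist_def by (simp add: bot_enat_def zero_enat_def)
qed

lemma orbit_gt_chain: "orbit_gt a b lam (chain_weight p m) (chain_weight p n) \<longleftrightarrow> n < m"
proof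
  assume "orbit_gt a b lam (chain_weight p m) (chain_weight p n)"
  then obtain u where u: "(chain_weight p m, chain_weight p n) \<in> orbit_step a b lam ^^ u" "m \<noteq> n"
    by (auto simp: orbit_gt_def orbit_ge_def dest: rtrancl_imp_relpow)
  then show "n < m"
    using orbit_steps_bound[OF u(1)] by simp
next
  assume "n < m"
  then show "orbit_gt a b lam (chain_weight p m) (chain_weight p n)"
    using chain_orbit_steps[of n "nat (m - n)"] orbit
    by (auto simp: orbit_gt_def orbit_ge_def chain_weight_inj dest: relpow_imp_rtrancl)
qed

text \<open>
  The coefficients of a positive real root in the basis of simple roots are integers, so if \<open>x\<^sub>n\<^sub>+\<^sub>1\<close> and \<open>x\<^sub>n\<close> are
  related by the reflection in \<open>\<beta>\<close>, then their difference \<open>p\<^sub>n \<alpha>\<^sub>i\<close> is minus the pairing times \<open>\<beta>\<close>, and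
  the pairing divides \<open>p\<^sub>n\<close>. This avoids identifying \<open>\<beta>\<close> with \<open>\<alpha>\<^sub>i\<close>.
\<close>

lemma reflection_integrality:
  fixes \<sigma> :: rat
  assumes \<beta>: "\<beta> \<in> pos_real_roots a b" and refl: "chain_weight p n = root_refl a b \<beta> (chain_weight p (n + 1))"
    and int: "\<sigma> * of_int (pairing (chain_weight p (n + 1)) (dual_root a b \<beta>)) \<in> \<int>"
  shows "\<sigma> * of_int (p n) \<in> \<int>"
proof -
  define P where "P = pairing (chain_weight p (n + 1)) (dual_root a b \<beta>)"
  obtain c d where cd: "\<beta> = smult2 c (simple_root a b I1) + smult2 d (simple_root a b I2)"
    using \<beta> by (auto simp: pos_real_roots_def)
  have "smult2 (p n) (simple_root a b (letter n)) = smult2 (- P) \<beta>"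
    using refl chain_weight_step[OF p, of n] by (simp add: root_refl_def P_def[symmetric] smult2_def)
  then have eqs: "p n * fst (simple_root a b (letter n)) = - P * (2 * c - a * d)"
    "p n * snd (simple_root a b (letter n)) = - P * (2 * d - b * c)"
    unfolding cd by (auto simp: smult2_def algebra_simps)
  have "\<exists>e. p n = - P * e"
  proof (cases "even n")
    case True
    then have "p n * 2 = - P * (2 * c - a * d)" "p n * b = P * (2 * d - b * c)"
      using eqs by (auto simp: letter_def algebra_simps)
    then have "b * (- P * (2 * c - a * d)) = 2 * (P * (2 * d - b * c))"
      by (metis mult.commute mult.left_commute)
    then have "P * d * (a * b - 4) = 0"
      by (simp add: algebra_simps)
    then have "P * d = 0"
      using ab by auto
    then have "p n = - P * c"
      using \<open>p n * 2 = _\<close> by (auto simp: algebra_simps)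
    then show ?thesis ..
  next
    case False
    then have "p n * a = P * (2 * c - a * d)" "p n * 2 = - P * (2 * d - b * c)"
      using eqs by (auto simp: letter_def algebra_simps)
    then have "a * (- P * (2 * d - b * c)) = 2 * (P * (2 * c - a * d))"
      by (metis mult.commute mult.left_commute)
    then have "P * c * (a * b - 4) = 0"
      by (simp add: algebra_simps)
    then have "P * c = 0"
      using ab by auto
    then have "p n = - P * d"
      using \<open>p n * 2 = _\<close> by (auto simp: algebra_simps)
    then show ?thesis ..
  qed
  then obtain e where "p n = - P * e" ..
  then have "\<sigma> * of_int (p n) = - (\<sigma> * of_int P) * of_int e"
    by simp
  then show ?thesis
    using int unfolding P_def[symmetric] by (simp add: Ints_mult)
qed

text \<open>
  Steps of distance one join neighbours, so a chain from \<open>x\<^sub>m\<close> to \<open>x\<^sub>n\<close> must run through all the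
  weights between them.
\<close>

lemma sigma_chain_iff:
  fixes \<sigma> :: rat
  assumes "0 < \<sigma>"
  shows "sigma_chain a b lam \<sigma> (chain_weight p m) (chain_weight p n) \<longleftrightarrow>
    n \<le> m \<and> (\<forall>j\<in>{n..<m}. \<sigma> * of_int (p j) \<in> \<int>)"
proof
  define E where "E \<mu> \<nu> \<longleftrightarrow> (\<exists>j. \<mu> = chain_weight p (j + 1) \<and> \<nu> = chain_weight p j \<and> \<sigma> * of_int (p j) \<in> \<int>)" for \<mu> \<nu>
  assume "sigma_chain a b lam \<sigma> (chain_weight p m) (chain_weight p n)"
  then obtain ms where ms: "ms \<noteq> []" "hd ms = chain_weight p m" "last ms = chain_weight p n"
    "set ms \<subseteq> weyl_orbit a b lam" and steps: "\<And>k. Suc k < length ms \<Longrightarrow>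
        orbit_dist a b lam (ms ! k) (ms ! Suc k) = 1 \<and>
        (\<exists>\<beta> \<in> pos_real_roots a b. ms ! Suc k = root_refl a b \<beta> (ms ! k) \<and>
           \<sigma> * of_int (pairing (ms ! k) (dual_root a b \<beta>)) \<in> \<int>)"
    unfolding sigma_chain_def by blast
  have "E (ms ! k) (ms ! Suc k)" if k: "Suc k < length ms" for k
  proof -
    have "ms ! k \<in> set ms" "ms ! Suc k \<in> set ms"
      using k by auto
    then obtain i j where ij: "ms ! k = chain_weight p i" "ms ! Suc k = chain_weight p j"
      using ms(4) orbit by blast
    then have "i = j + 1"
      using steps[OF k] orbit_dist_chain[of i j] by (auto simp: one_enat_def)
    then show ?thesis
      using steps[OF k] ij reflection_integrality unfolding E_def by metis
  qed
  then have "successively E ms"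
    by (simp add: successively_conv_nth)
  then show "n \<le> m \<and> (\<forall>j\<in>{n..<m}. \<sigma> * of_int (p j) \<in> \<int>)"
    using ms(1-3)
  proof (induction ms arbitrary: m)
    case (Cons \<mu> ms)
    show ?case
    proof (cases "ms = []")
      case True
      then show ?thesis
        using Cons.prems by (simp add: chain_weight_inj)
    next
      case False
      then obtain j where j: "\<mu> = chain_weight p (j + 1)" "hd ms = chain_weight p j" "\<sigma> * of_int (p j) \<in> \<int>"
        using Cons.prems(1) by (auto simp: successively_Cons E_def)
      then have "m = j + 1"
        using Cons.prems by (simp add: chain_weight_inj)
      moreover have "n \<le> j \<and> (\<forall>i\<in>{n..<j}. \<sigma> * of_int (p i) \<in> \<int>)"
        using Cons.IH[of j] Cons.prems False j by (simp add: successively_Cons)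
      ultimately show ?thesis
        using j(3) by (auto simp: less_le)
    qed
  qed simp
next
  assume nm: "n \<le> m \<and> (\<forall>j\<in>{n..<m}. \<sigma> * of_int (p j) \<in> \<int>)"
  define L where "L = nat (m - n)"
  define ms where "ms = map (\<lambda>i. chain_weight p (m - int i)) [0..<Suc L]"
  have nth: "ms ! i = chain_weight p (m - int i)" if "i \<le> L" for i
    using that unfolding ms_def by (simp del: upt_Suc)
  have len: "length ms = Suc L"
    by (simp add: ms_def)
  show "sigma_chain a b lam \<sigma> (chain_weight p m) (chain_weight p n)"
    unfolding sigma_chain_def
  proof (intro exI[of _ ms] conjI allI impI)
    show ne: "ms \<noteq> []"
      using len by auto
    show "hd ms = chain_weight p m"
      using nth[of 0] ne by (simp add: hd_conv_nth)
    show "last ms = chain_weight p n"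
      using nth[of L] ne len nm by (simp add: last_conv_nth L_def)
    show "set ms \<subseteq> weyl_orbit a b lam"
      unfolding orbit ms_def by auto
    fix k
    assume k: "Suc k < length ms"
    define j where "j = m - int (Suc k)"
    have kj: "ms ! k = chain_weight p (j + 1)" "ms ! Suc k = chain_weight p j" "j \<in> {n..<m}"
      using nth[of k] nth[of "Suc k"] k len by (auto simp: j_def L_def)
    show "orbit_dist a b lam (ms ! k) (ms ! Suc k) = 1"
      unfolding kj orbit_dist_chain by (simp add: one_enat_def)
    have "\<sigma> * of_int (p j) \<in> \<int>" "0 < \<sigma> * of_int (p j)"
      using nm kj(3) assms p_pos by auto
    then show "\<exists>\<beta> \<in> pos_real_roots a b. ms ! Suc k = root_refl a b \<beta> (ms ! k) \<and>
        \<sigma> * of_int (pairing (ms ! k) (dual_root a b \<beta>)) \<in> \<int> \<and>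
        \<sigma> * of_int (pairing (ms ! k) (dual_root a b \<beta>)) < 0"
      using chain_weight_down[OF p, of j] a b ab
      by (intro bexI[OF _ simple_root_pos[of "letter j"]])
         (simp add: kj root_refl_simple dual_root_simple pairing_chain)
  qed
qed

end

section \<open>The path of a turning sequence\<close>

text \<open>
  Outside of \<open>lo, \<dots>, hi\<close> the entries are trivial; the path visits only weights with indices in this range.
\<close>

definition bounds :: "(int \<Rightarrow> int) \<Rightarrow> (int \<Rightarrow> int) \<Rightarrow> int \<Rightarrow> int \<Rightarrow> bool" where
  "bounds p d lo hi \<longleftrightarrow> lo \<le> hi \<and> (\<forall>n\<ge>hi. d n = 0) \<and> (\<forall>n<lo. d n = p n)"

lemma turning_sequence_bounds:
  assumes "turning_sequence p d"
  obtains lo hi where "bounds p d lo hi"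
proof -
  obtain N1 N2 where "\<forall>n\<ge>N1. d n = 0" "\<forall>n\<le>N2. d n = p n"
    using assms by (auto simp: turning_sequence_def)
  then have "bounds p d (min N1 N2) N1"
    by (auto simp: bounds_def)
  then show ?thesis
    using that by blast
qed

lemma bounds_widen: "bounds p d lo hi \<Longrightarrow> lo' \<le> lo \<Longrightarrow> hi \<le> hi' \<Longrightarrow> bounds p d lo' hi'"
  by (auto simp: bounds_def)

lemma bounds_update: "bounds p d lo hi \<Longrightarrow> lo \<le> j \<Longrightarrow> j < hi \<Longrightarrow> bounds p (d(j := x)) lo hi"
  by (auto simp: bounds_def)

lemma real_weight_add: "real_weight (u + v) = real_weight u + real_weight v"
  and real_weight_smult2: "real_weight (smult2 c v) = of_int c *\<^sub>R real_weight v"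
  and real_weight_simple_root: "real_weight (simple_root a b i) = simple_root a b i"
  by (auto simp: real_weight_def smult2_def) (cases i; simp)

lemma pairing_real:
  fixes u v :: "real \<times> real"
  shows "pairing (u + v) h = pairing u h + pairing v h"
    "pairing (u - v) h = pairing u h - pairing v h"
    "pairing (c *\<^sub>R v) h = c * pairing v h"
  by (auto simp: pairing_def algebra_simps)

lemma pairing_real_sum:
  fixes f :: "'i \<Rightarrow> real \<times> real"
  shows "pairing (sum f A) h = (\<Sum>x\<in>A. pairing (f x) h)"
  by (induction A rule: infinite_finite_induct) (auto simp: pairing_real, auto simp: pairing_def)

lemma simple_refl_real:
  fixes v :: "real \<times> real"
  shows "simple_refl a b i v = v - pairing v (simple_coroot i) *\<^sub>R simple_root a b i"
  by (simp add: simple_refl_def smult2_def scaleR_prod_def)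

lemma pairing_real_weight: "pairing (real_weight v) (simple_coroot i) = of_int (pairing v (simple_coroot i))"
  by (cases i) (auto simp: real_weight_def pairing_def)

lemma pairing_roots:
  "pairing (simple_root a b (letter j)) (simple_coroot (letter n)) =
    (if even (j - n) then 2 else - (of_int (coef a b j) :: real))"
  by (auto simp: pairing_def letter_def coef_def)

context weight_chain
begin

definition root_at :: "int \<Rightarrow> real \<times> real" where
  "root_at n = simple_root a b (letter n)"

text \<open>
  Closed form of the path: its derivative at a time \<open>t\<close> is the sum of the weight with index \<open>hi\<close> and
  of the differences \<open>x\<^sub>j - x\<^sub>j\<^sub>+\<^sub>1 = p\<^sub>j \<alpha>\<close>, with \<open>\<alpha>\<close> a simple root, for those \<open>j\<close> with
  \<open>d j / p j < t\<close>. In this form, changing one entry of \<open>d\<close> changes just one summand.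
\<close>

definition trace :: "int \<Rightarrow> int \<Rightarrow> (int \<Rightarrow> int) \<Rightarrow> real \<Rightarrow> real \<times> real" where
  "trace lo hi d t = t *\<^sub>R real_weight (chain_weight p hi) +
     (\<Sum>j\<in>{lo..<hi}. max 0 (real_of_int (p j) * t - real_of_int (d j)) *\<^sub>R root_at j)"

lemma real_chain_weight_step:
  "real_weight (chain_weight p n) = real_weight (chain_weight p (n + 1)) + real_of_int (p n) *\<^sub>R root_at n"
  by (subst chain_weight_step[OF p])
     (simp add: real_weight_add real_weight_smult2 real_weight_simple_root root_at_def)

lemma trace_up:
  assumes "d hi = 0" "lo \<le> hi" "0 \<le> t"
  shows "trace lo (hi + 1) d t = trace lo hi d t"
proof -
  have "{lo..<hi + 1} = insert hi {lo..<hi}"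
    using assms by auto
  then show ?thesis
    using assms p_pos[of hi] by (simp add: trace_def real_chain_weight_step[of hi] algebra_simps max_def)
qed

lemma trace_down:
  assumes "d (lo - 1) = p (lo - 1)" "lo \<le> hi" "t \<le> 1"
  shows "trace (lo - 1) hi d t = trace lo hi d t"
proof -
  have "{lo - 1..<hi} = insert (lo - 1) {lo..<hi}"
    using assms by auto
  moreover have "real_of_int (p (lo - 1)) * t - real_of_int (p (lo - 1)) \<le> 0"
    using assms p_pos[of "lo - 1"] by (simp add: mult_left_le)
  ultimately show ?thesis
    using assms by (simp add: trace_def max_absorb1)
qed

lemma trace_widen:
  assumes "bounds p d lo hi" "lo' \<le> lo" "hi \<le> hi'" "0 \<le> t" "t \<le> 1"
  shows "trace lo' hi' d t = trace lo hi d t"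
proof -
  have 1: "trace lo (hi + int i) d t = trace lo hi d t" for i
  proof (induction i)
    case (Suc i)
    have "trace lo (hi + int i + 1) d t = trace lo (hi + int i) d t"
      using assms by (intro trace_up) (auto simp: bounds_def)
    then show ?case
      using Suc by (simp add: add_ac)
  qed simp
  have 2: "trace (lo - int i) hi' d t = trace lo hi' d t" for i
  proof (induction i)
    case (Suc i)
    have "trace (lo - int i - 1) hi' d t = trace (lo - int i) hi' d t"
      using assms by (intro trace_down) (auto simp: bounds_def)
    then show ?case
      using Suc by (simp add: algebra_simps)
  qed simp
  show ?thesis
    using 1[of "nat (hi' - hi)"] 2[of "nat (lo - lo')"] assms by simp
qed

text \<open>
  Any choice of bounds gives the same path, see \<open>turning_path_eq\<close>.
\<close>

definition turning_path :: "(int \<Rightarrow> int) \<Rightarrow> path" where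
  "turning_path d = (let (lo, hi) = (SOME (lo, hi). bounds p d lo hi) in restrict (trace lo hi d) {0..1})"

lemma turning_path_eq:
  assumes "bounds p d lo hi"
  shows "turning_path d = restrict (trace lo hi d) {0..1}"
proof -
  obtain lo0 hi0 where some: "(SOME (lo, hi). bounds p d lo hi) = (lo0, hi0)"
    by (cases "SOME (lo, hi). bounds p d lo hi")
  have "\<exists>x. case x of (lo, hi) \<Rightarrow> bounds p d lo hi"
    using assms by auto
  from someI_ex[OF this] have 0: "bounds p d lo0 hi0"
    by (simp add: some)
  have "trace lo0 hi0 d t = trace lo hi d t" if "t \<in> {0..1}" for t
    using trace_widen[OF 0, of "min lo0 lo" "max hi0 hi" t] trace_widen[OF assms, of "min lo0 lo" "max hi0 hi" t] that
    by simp
  then show ?thesis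
    by (auto simp: turning_path_def some)
qed

definition turn_time :: "(int \<Rightarrow> int) \<Rightarrow> int \<Rightarrow> real" where
  "turn_time d n = real_of_int (d n) / real_of_int (p n)"

lemma turn_time_le: "turn_time d n \<le> t \<longleftrightarrow> real_of_int (d n) \<le> real_of_int (p n) * t"
  and le_turn_time: "t \<le> turn_time d n \<longleftrightarrow> real_of_int (p n) * t \<le> real_of_int (d n)"
  using p_pos[of n] by (auto simp: turn_time_def field_simps)

lemma turn_time_range:
  assumes "turning_sequence p d"
  shows "0 \<le> turn_time d n" "turn_time d n \<le> 1"
proof -
  have "0 \<le> d n" "d n \<le> p n"
    using assms by (auto simp: turning_sequence_def)
  then show "0 \<le> turn_time d n" "turn_time d n \<le> 1"
    by (auto simp: turn_time_le le_turn_time)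
qed

lemma turn_time_antimono:
  assumes d: "turning_sequence p d" and "m \<le> n"
  shows "turn_time d n \<le> turn_time d m"
  using \<open>m \<le> n\<close>
proof (induction n rule: int_ge_induct)
  case (step n)
  have "d (n + 1) * p n \<le> d n * p (n + 1)"
    using d by (auto simp: turning_sequence_def)
  then have "real_of_int (d (n + 1)) * p n \<le> real_of_int (d n) * p (n + 1)"
    by (metis of_int_le_iff of_int_mult)
  then have "turn_time d (n + 1) \<le> turn_time d n"
    using p_pos[of n] p_pos[of "n + 1"] by (simp add: turn_time_def field_simps)
  then show ?case
    using step by simp
qed simp

lemma real_chain_weight_telescope:
  assumes "n \<le> hi"
  shows "real_weight (chain_weight p n) =
    real_weight (chain_weight p hi) + (\<Sum>j\<in>{n..<hi}. real_of_int (p j) *\<^sub>R root_at j)"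
  using assms
proof (induction hi rule: int_ge_induct)
  case (step i)
  have "{n..<i + 1} = insert i {n..<i}"
    using step by auto
  then show ?case
    using step real_chain_weight_step[of i] by (simp add: algebra_simps)
qed simp

text \<open>
  Between the times of \<open>n + 1\<close> and \<open>n - 1\<close> the path first follows \<open>x\<^sub>n\<^sub>+\<^sub>1\<close> and then \<open>x\<^sub>n\<close>, whose pairings
  with the coroot are \<open>- p n\<close> and \<open>p n\<close>; so the height is a V with its tip at the time of \<open>n\<close>. The
  height of the tip is computed from the closed form of the path.
\<close>

lemma height_formula:
  assumes d: "turning_sequence p d" and hi: "\<forall>n\<ge>hi. d n = 0"
    and t: "t \<in> {0..1}" "turn_time d (n + 1) \<le> t" "t \<le> turn_time d (n - 1)"
  shows "height (letter n) (turning_path d) t = bottom (coef a b) d hi n + \<bar>real_of_int (p n) * t - real_of_int (d n)\<bar>"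
proof -
  obtain lo0 hi0 where bd0: "bounds p d lo0 hi0"
    using turning_sequence_bounds[OF d] .
  \<comment> \<open>bounds that enclose \<open>n\<close>, so that the summand with index \<open>n\<close> occurs in the closed form\<close>
  define lo where "lo = min lo0 n"
  define M where "M = max (max hi hi0) (n + 1)"
  have bd: "bounds p d lo M"
    using bd0 by (rule bounds_widen) (auto simp: lo_def M_def)
  have loM: "lo \<le> n" "n < M" "hi \<le> M"
    by (auto simp: lo_def M_def)
  define y where "y = real_of_int (p n) * t - real_of_int (d n)"
  have low: "max 0 (real_of_int (p j) * t - real_of_int (d j)) = 0" if "j < n" for j
  proof -
    have "t \<le> turn_time d j"
      using turn_time_antimono[OF d, of j "n - 1"] t that by simp
    then show ?thesis
      by (simp add: le_turn_time)
  qed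
  have high: "max 0 (real_of_int (p j) * t - real_of_int (d j)) = real_of_int (p j) * t - real_of_int (d j)" if "n < j" for j
  proof -
    have "turn_time d j \<le> t"
      using turn_time_antimono[OF d, of "n + 1" j] t that by simp
    then show ?thesis
      by (simp add: turn_time_le)
  qed
  have split: "{lo..<M} = {lo..<n} \<union> insert n {n + 1..<M}"
    using loM by auto
  have "(\<Sum>j\<in>{lo..<M}. max 0 (real_of_int (p j) * t - real_of_int (d j)) *\<^sub>R root_at j) =
      (\<Sum>j\<in>{lo..<n}. max 0 (real_of_int (p j) * t - real_of_int (d j)) *\<^sub>R root_at j) +
      (max 0 y *\<^sub>R root_at n + (\<Sum>j\<in>{n + 1..<M}. max 0 (real_of_int (p j) * t - real_of_int (d j)) *\<^sub>R root_at j))"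
    unfolding split y_def by (subst sum.union_disjoint) auto
  also have "(\<Sum>j\<in>{lo..<n}. max 0 (real_of_int (p j) * t - real_of_int (d j)) *\<^sub>R root_at j) = 0"
    by (intro sum.neutral) (simp add: low)
  also have "(\<Sum>j\<in>{n + 1..<M}. max 0 (real_of_int (p j) * t - real_of_int (d j)) *\<^sub>R root_at j) =
      (\<Sum>j\<in>{n + 1..<M}. t *\<^sub>R (real_of_int (p j) *\<^sub>R root_at j) - real_of_int (d j) *\<^sub>R root_at j)"
  proof (intro sum.cong refl)
    fix j assume "j \<in> {n + 1..<M}"
    then have "n < j"
      by simp
    then show "max 0 (real_of_int (p j) * t - real_of_int (d j)) *\<^sub>R root_at j =
        t *\<^sub>R (real_of_int (p j) *\<^sub>R root_at j) - real_of_int (d j) *\<^sub>R root_at j"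
      unfolding high[OF \<open>n < j\<close>] by (simp add: algebra_simps)
  qed
  also have "\<dots> = t *\<^sub>R (\<Sum>j\<in>{n + 1..<M}. real_of_int (p j) *\<^sub>R root_at j) - (\<Sum>j\<in>{n + 1..<M}. real_of_int (d j) *\<^sub>R root_at j)"
    by (simp add: sum_subtractf scaleR_sum_right)
  finally have "turning_path d t = t *\<^sub>R real_weight (chain_weight p (n + 1)) + max 0 y *\<^sub>R root_at n
      - (\<Sum>j\<in>{n + 1..<M}. real_of_int (d j) *\<^sub>R root_at j)"
    using t loM real_chain_weight_telescope[of "n + 1" M]
    by (simp add: turning_path_eq[OF bd] trace_def algebra_simps)
  moreover have cast: "real_of_int (if c then 2 else - x) = (if c then 2 else - real_of_int x)" for c x
    by simp
  ultimately have "height (letter n) (turning_path d) t = - t * p n + 2 * max 0 y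
      - (\<Sum>j\<in>{n + 1..<M}. d j * (if even (j - n) then 2 else - coef a b j))"
    unfolding height_def
    by (simp add: pairing_real pairing_real_sum pairing_real_weight pairing_chain root_at_def pairing_roots
        cast del: even_diff)
  also have "(\<Sum>j\<in>{n + 1..<M}. d j * (if even (j - n) then 2 else - coef a b j)) = - bottom (coef a b) d M n - d n"
    unfolding bottom_def
    by (simp add: sum_negf[symmetric], intro sum.cong) auto
  also have "2 * max 0 y = \<bar>y\<bar> + y"
    by (simp add: max_def abs_if)
  finally show ?thesis
    using bottom_indep[OF hi loM(3)] by (simp add: y_def algebra_simps)
qed

text \<open>
  The intervals of \<open>height_formula\<close> for indices \<open>n\<close> of one parity cover \<open>[0, 1]\<close>.
\<close>

lemma interval_around:
  assumes d: "turning_sequence p d" and t: "t \<in> {0..1}"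
  obtains n where "letter n = i" "turn_time d (n + 1) \<le> t" "t \<le> turn_time d (n - 1)"
proof -
  obtain lo hi where bd: "bounds p d lo hi"
    using turning_sequence_bounds[OF d] .
  have low: "turn_time d n = 1" if "n < lo" for n
    using bd that p_pos[of n] by (simp add: turn_time_def bounds_def)
  have high: "turn_time d n = 0" if "hi \<le> n" for n
    using bd that by (simp add: turn_time_def bounds_def)
  obtain m where m: "m < lo" "letter m = i"
  proof (cases "letter (lo - 1) = i")
    case False
    then have "letter (lo - 2) = i"
      using letter_cases[of i "lo - 1"] by auto
    then show ?thesis
      using that[of "lo - 2"] by simp
  qed (use that[of "lo - 1"] in simp)
  have shift: "letter (m + 2 * int u) = i" for u
    using m(2) by (simp add: letter_def)
  show ?thesis
  proof (cases "\<exists>u. turn_time d (m + 2 * int u + 1) \<le> t")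
    case True
    define u where "u = (LEAST u. turn_time d (m + 2 * int u + 1) \<le> t)"
    have u: "turn_time d (m + 2 * int u + 1) \<le> t"
      unfolding u_def using True by (rule LeastI_ex)
    have "t \<le> turn_time d (m + 2 * int u - 1)"
    proof (cases u)
      case 0
      then show ?thesis
        using low[of "m - 1"] m t by simp
    next
      case (Suc v)
      then have "\<not> turn_time d (m + 2 * int v + 1) \<le> t"
        using not_less_Least[of v "\<lambda>u. turn_time d (m + 2 * int u + 1) \<le> t"] by (simp add: u_def)
      then show ?thesis
        by (simp add: Suc algebra_simps)
    qed
    then show ?thesis
      using that[OF shift u] by blast
  next
    case False
    moreover have "turn_time d (m + 2 * int (nat (hi - m)) + 1) = 0"
      by (rule high) simp
    ultimately show ?thesis
      using t by (metis atLeastAtMost_iff)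
  qed
qed

end

section \<open>Root operators on turning sequences\<close>

context weight_chain
begin

lemma letter_eq_iff: "letter m = letter n \<longleftrightarrow> even (m - n)"
  by (auto simp: letter_def)

text \<open>
  The height function is known from its V-shaped pieces: its minimum is the smallest tip, last
  attained at the time \<open>s\<close> of \<open>j\<close>, and from there it rises with slope \<open>p j\<close> until it has gained \<open>1\<close> at
  \<open>s + 1 / p j\<close>. This is the time of \<open>j\<close> in the new sequence. Reflecting the segment between
  these times has the same effect on the path as the change of the \<open>j\<close>-th summand in its closed form.
\<close>

lemma f_op_acts:
  assumes d: "turning_sequence p d" and f: "f_acts_at (coef a b) d j"
  shows "f_op a b (letter j) (turning_path d) = Some (turning_path (d(j := d j + 1)))"
proof -
  let ?H = "height (letter j) (turning_path d)"
  define d' where "d' = d(j := d j + 1)"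
  have d': "turning_sequence p d'"
    unfolding d'_def by (rule turning_sequence_f[OF p p_pos d f])
  obtain lo0 hi0 where bd0: "bounds p d lo0 hi0"
    using turning_sequence_bounds[OF d] .
  define lo where "lo = min lo0 j"
  define hi where "hi = max hi0 (j + 1)"
  have bd: "bounds p d lo hi"
    using bd0 by (rule bounds_widen) (auto simp: lo_def hi_def)
  have j: "lo \<le> j" "j < hi"
    by (auto simp: lo_def hi_def)
  have zero: "\<forall>n\<ge>hi. d n = 0"
    using bd by (simp add: bounds_def)
  define h where "h = bottom (coef a b) d hi"
  have h: "h j \<le> h l" if "j < l" "even (l - j)" for l
    using f_acts_at_bottom(1)[OF f zero that(2,1)] by (simp add: h_def)
  have h': "h j < h l" if "l < j" "even (l - j)" for l
    using f_acts_at_bottom(2)[OF f zero that(2,1)] by (simp add: h_def)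
  define s where "s = turn_time d j"
  define s' where "s' = turn_time d' j"
  have s': "s' = s + 1 / p j"
    by (simp add: s_def s'_def d'_def turn_time_def add_divide_distrib)
  have ss': "0 \<le> s" "s < s'" "s' \<le> 1"
  proof -
    show "0 \<le> s"
      unfolding s_def by (rule turn_time_range[OF d])
    show "s < s'"
      using s' p_pos[of j] by simp
    show "s' \<le> 1"
      unfolding s'_def by (rule turn_time_range[OF d'])
  qed
  have nbr: "turn_time d (j + 1) \<le> s" "s \<le> turn_time d (j - 1)" "s' \<le> turn_time d (j - 1)"
  proof -
    show "turn_time d (j + 1) \<le> s" "s \<le> turn_time d (j - 1)"
      unfolding s_def by (rule turn_time_antimono[OF d]; simp)+
    have "s' \<le> turn_time d' (j - 1)"
      unfolding s'_def by (rule turn_time_antimono[OF d']; simp)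
    then show "s' \<le> turn_time d (j - 1)"
      by (simp add: d'_def turn_time_def)
  qed
  have near: "?H t = h j + \<bar>real_of_int (p j) * t - d j\<bar>" if "s \<le> t" "t \<le> s'" for t
    unfolding h_def by (rule height_formula[OF d zero]) (use that nbr ss' in auto)
  have base: "p j * s = d j" "p j * s' = d j + 1"
    using p_pos[of j] by (simp_all add: s_def s' turn_time_def field_simps)
  have below: "h j \<le> ?H t" if "t \<in> {0..1}" for t
  proof -
    obtain n where n: "letter n = letter j" "turn_time d (n + 1) \<le> t" "t \<le> turn_time d (n - 1)"
      using interval_around[OF d \<open>t \<in> {0..1}\<close>] by metis
    have "h j \<le> h n"
      using h[of n] h'[of n] n(1) by (cases n j rule: linorder_cases) (auto simp: letter_eq_iff)
    moreover have "?H t = h n + \<bar>real_of_int (p n) * t - d n\<bar>"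
      using height_formula[OF d zero that n(2,3)] n(1) by (simp add: h_def)
    ultimately show ?thesis
      by linarith
  qed
  have after: "h j < ?H t" if "t \<in> {0..1}" "s < t" for t
  proof -
    obtain n where n: "letter n = letter j" "turn_time d (n + 1) \<le> t" "t \<le> turn_time d (n - 1)"
      using interval_around[OF d \<open>t \<in> {0..1}\<close>] by metis
    have H: "?H t = h n + \<bar>real_of_int (p n) * t - d n\<bar>"
      using height_formula[OF d zero that(1) n(2,3)] n(1) by (simp add: h_def)
    have "n \<le> j"
    proof (rule ccontr)
      assume "\<not> n \<le> j"
      then have "turn_time d (n - 1) \<le> s"
        unfolding s_def by (intro turn_time_antimono[OF d]) simp
      then show False
        using n(3) that(2) by simp
    qed
    show ?thesis
    proof (cases "n = j")
      case True
      have "\<not> t \<le> turn_time d j"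
        using that(2) by (simp add: s_def)
      then show ?thesis
        using H True by (simp add: le_turn_time)
    next
      case False
      then have "h j < h n"
        using h'[of n] \<open>n \<le> j\<close> n(1) by (simp add: letter_eq_iff)
      then show ?thesis
        using H by simp
    qed
  qed
  have Hs: "?H s = h j" and Hs': "?H s' = real_of_int (h j) + 1"
    using near[of s] near[of s'] ss' base by auto
  have m: "min_height (letter j) (turning_path d) = h j"
    unfolding min_height_def
  proof (rule Least_equality)
    show "real_of_int (h j) \<in> ?H ` {0..1}"
      using Hs ss' by (intro image_eqI[of _ _ s]) auto
  qed (use below in auto)
  have t0: "(GREATEST t. t \<in> {0..1} \<and> ?H t = h j) = s"
    by (rule Greatest_equality) (use Hs ss' after in force)+
  have t1: "(LEAST t. t \<in> {s..1} \<and> ?H t = real_of_int (h j) + 1) = s'"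
  proof (rule Least_equality)
    show "s' \<in> {s..1} \<and> ?H s' = real_of_int (h j) + 1"
      using Hs' ss' by simp
    fix t assume t: "t \<in> {s..1} \<and> ?H t = real_of_int (h j) + 1"
    show "s' \<le> t"
    proof (rule ccontr)
      assume "\<not> s' \<le> t"
      then have "real_of_int (p j) * t < p j * s'" "p j * s \<le> real_of_int (p j) * t"
        using p_pos[of j] t by auto
      then show False
        using near[of t] t \<open>\<not> s' \<le> t\<close> base by auto
    qed
  qed
  have "h j \<noteq> ?H 1"
    using after[of 1] ss' by force
  have "f_op a b (letter j) (turning_path d) = Some (restrict (\<lambda>t.
             if t \<le> s then turning_path d t
             else if t \<le> s' then simple_refl a b (letter j) (turning_path d t - turning_path d s) + turning_path d s
             else turning_path d t - simple_root a b (letter j)) {0..1})"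
    using \<open>h j \<noteq> ?H 1\<close> unfolding f_op_def m Let_def t0 t1 by simp
  also have "restrict (\<lambda>t.
             if t \<le> s then turning_path d t
             else if t \<le> s' then simple_refl a b (letter j) (turning_path d t - turning_path d s) + turning_path d s
             else turning_path d t - simple_root a b (letter j)) {0..1} = turning_path d'"
  proof -
    have bd': "bounds p d' lo hi"
      unfolding d'_def by (rule bounds_update[OF bd j])
    have diff: "turning_path d' t = turning_path d t +
        (max 0 (p j * t - d j - 1) - max 0 (p j * t - d j)) *\<^sub>R root_at j" if "t \<in> {0..1}" for t :: real
    proof -
      have "(\<Sum>i\<in>{lo..<hi} - {j}. max 0 (real_of_int (p i) * t - real_of_int (d' i)) *\<^sub>R root_at i)
          = (\<Sum>i\<in>{lo..<hi} - {j}. max 0 (real_of_int (p i) * t - real_of_int (d i)) *\<^sub>R root_at i)"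
        by (intro sum.cong) (auto simp: d'_def)
      moreover have "turning_path e t = t *\<^sub>R real_weight (chain_weight p hi) +
          (max 0 (real_of_int (p j) * t - real_of_int (e j)) *\<^sub>R root_at j +
           (\<Sum>i\<in>{lo..<hi} - {j}. max 0 (real_of_int (p i) * t - real_of_int (e i)) *\<^sub>R root_at i))"
        if "bounds p e lo hi" for e
        using \<open>t \<in> {0..1}\<close> j unfolding turning_path_eq[OF that] trace_def
        by (simp add: sum.remove[of "{lo..<hi}" j])
      ultimately show ?thesis
        using bd bd' by (simp add: d'_def algebra_simps)
    qed
    show ?thesis
    proof
      fix t
      show "restrict (\<lambda>t. if t \<le> s then turning_path d t
             else if t \<le> s' then simple_refl a b (letter j) (turning_path d t - turning_path d s) + turning_path d s
             else turning_path d t - simple_root a b (letter j)) {0..1} t = turning_path d' t"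
      proof (cases "t \<in> {0..1}")
        case False
        then show ?thesis
          unfolding turning_path_eq[OF bd'] restrict_apply by (simp only: if_False)
      next
        case True
        have order: "t \<le> s \<longleftrightarrow> p j * t \<le> d j" "t \<le> s' \<longleftrightarrow> p j * t \<le> d j + 1"
          by (simp_all add: s_def s'_def le_turn_time d'_def)
        consider "t \<le> s" | "s < t" "t \<le> s'" | "s' < t"
          by linarith
        then show ?thesis
        proof cases
          case 1
          then show ?thesis
            using True order diff[OF True] by (simp add: max_def)
        next
          case 2
          have "?H t - ?H s = p j * t - d j"
            using near[of t] Hs 2 order by simp
          then have "pairing (turning_path d t - turning_path d s) (simple_coroot (letter j)) = p j * t - d j"
            by (simp add: height_def pairing_real)
          moreover have "max 0 (p j * t - d j - 1) = 0" "max 0 (p j * t - d j) = p j * t - d j"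
            using 2 order by auto
          then have "turning_path d' t = turning_path d t - (p j * t - d j) *\<^sub>R root_at j"
            using diff[OF True] by (simp add: scaleR_diff_left)
          ultimately show ?thesis
            using True 2 by (simp add: simple_refl_real root_at_def)
        next
          case 3
          then show ?thesis
            using True order diff[OF True] ss'
            by (simp add: max_def root_at_def)
        qed
      qed
    qed
  qed
  finally show ?thesis
    by (simp add: d'_def)
qed

text \<open>
  The height at \<open>1\<close> is the common height of all tips far to the left. If no tip were lower, it would be
  the minimum and the operator would give \<^const>\<open>None\<close>.
\<close>

lemma f_op_Some:
  assumes d: "turning_sequence p d" and some: "f_op a b i (turning_path d) = Some \<pi>"
  obtains j where "f_acts_at (coef a b) d j" "i = letter j" "\<pi> = turning_path (d(j := d j + 1))"
proof -
  let ?H = "height i (turning_path d)"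
  obtain lo hi where bd: "bounds p d lo hi"
    using turning_sequence_bounds[OF d] .
  then have zero: "\<forall>n\<ge>hi. d n = 0" and full: "\<And>n. n < lo \<Longrightarrow> d n = p n"
    by (auto simp: bounds_def)
  define h where "h = bottom (coef a b) d hi"
  obtain m where m: "i = letter m"
    using letter_cases[of i 0] by blast
  have low: "real_of_int (h l) = ?H 1" if "l < lo" "letter l = i" for l
  proof -
    have "turn_time d (l - 1) = 1"
      using full[of "l - 1"] that p_pos[of "l - 1"] by (simp add: turn_time_def)
    then show ?thesis
      using height_formula[OF d zero, of 1 l] turn_time_range[OF d] full[of l] that
      by (simp add: h_def)
  qed
  obtain l0 where l0: "l0 < lo" "letter l0 = i"
  proof (cases "letter (lo - 1) = i")
    case False
    then have "letter (lo - 2) = i"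
      using letter_cases[of i "lo - 1"] by auto
    then show ?thesis
      using that[of "lo - 2"] by simp
  qed (use that[of "lo - 1"] in simp)
  define w where "w = h l0"
  have w: "real_of_int w = ?H 1"
    using low[OF l0] by (simp add: w_def)
  have "\<exists>n. letter n = i \<and> h n < w"
  proof (rule ccontr)
    assume none: "\<not> (\<exists>n. letter n = i \<and> h n < w)"
    have "w \<le> ?H t" if t: "t \<in> {0..1}" for t
    proof -
      obtain n where n: "letter n = i" "turn_time d (n + 1) \<le> t" "t \<le> turn_time d (n - 1)"
        using interval_around[OF d t] by metis
      then have "w \<le> h n"
        using none by force
      moreover have "?H t = h n + \<bar>real_of_int (p n) * t - d n\<bar>"
        using height_formula[OF d zero t n(2,3)] n(1) by (simp add: h_def)
      ultimately show ?thesis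
        by linarith
    qed
    then have "min_height i (turning_path d) = ?H 1"
      unfolding min_height_def w[symmetric]
      by (intro Least_equality) (auto simp: w intro: image_eqI[of _ _ 1])
    then show False
      using some by (simp add: f_op_def)
  qed
  then obtain n where n: "letter n = i" "h n < w"
    by blast
  have "\<exists>j. even (j - m) \<and> (\<forall>l>j. even (l - j) \<longrightarrow> h j \<le> h l) \<and> (\<forall>l<j. even (l - j) \<longrightarrow> h j < h l)"
  proof (rule first_minimum[of hi m h 0 lo w n])
    show "h l = 0" if "hi \<le> l" for l
      using bottom_above[OF zero that] by (simp add: h_def)
    show "h l = w" if "l < lo" "even (l - m)" for l
      using low[of l] w that by (simp add: m letter_eq_iff)
    show "h n < w" "even (n - m)"
      using n by (auto simp: m letter_eq_iff)
  qed
  then obtain j where j: "even (j - m)" "f_acts_at (coef a b) d j"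
    using min_heights_bottom[OF zero] unfolding f_acts_at_def h_def by blast
  then have "i = letter j"
    by (simp add: m letter_eq_iff)
  then show ?thesis
    using that j(2) f_op_acts[OF d j(2)] some by simp
qed

text \<open>
  Consider the largest index \<open>k\<close> at which two sequences differ, and the later of the two times of
  \<open>k\<close>. At that time the two paths differ by a nonnegative combination of simple
  roots with a positive coefficient at index \<open>k\<close>, which is not zero because simple roots have positive level.
\<close>

lemma turning_path_inj:
  assumes d: "turning_sequence p d" and e: "turning_sequence p e" and eq: "turning_path d = turning_path e"
  shows "d = e"
proof (rule ccontr)
  assume ne: "d \<noteq> e"
  have main: False if d: "turning_sequence p d" and e: "turning_sequence p e"
    and eq: "turning_path d = turning_path e" and k: "d k < e k" "\<And>l. k < l \<Longrightarrow> d l = e l" for d e k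
  proof -
    obtain lo1 hi1 lo2 hi2 where "bounds p d lo1 hi1" "bounds p e lo2 hi2"
      using turning_sequence_bounds d e by metis
    then have bd: "bounds p d (min k (min lo1 lo2)) (max (k + 1) (max hi1 hi2))"
      and be: "bounds p e (min k (min lo1 lo2)) (max (k + 1) (max hi1 hi2))"
      by (auto elim!: bounds_widen)
    define lo where "lo = min k (min lo1 lo2)"
    define hi where "hi = max (k + 1) (max hi1 hi2)"
    have k_in: "k \<in> {lo..<hi}"
      by (auto simp: lo_def hi_def)
    \<comment> \<open>at this time the index \<open>k\<close> has been passed by the path of \<open>d\<close>, but none of the indices up to \<open>k\<close> by that of \<open>e\<close>\<close>
    define t where "t = turn_time e k"
    have t: "t \<in> {0..1}"
      using turn_time_range[OF e] by (simp add: t_def)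
    define u where "u j = max 0 (real_of_int (p j) * t - real_of_int (d j))
        - max 0 (real_of_int (p j) * t - real_of_int (e j))" for j
    have sum0: "(\<Sum>j\<in>{lo..<hi}. u j *\<^sub>R root_at j) = 0"
      using fun_cong[OF eq, of t] t unfolding turning_path_eq[OF bd] turning_path_eq[OF be]
      by (simp add: trace_def u_def lo_def hi_def scaleR_diff_left sum_subtractf)
    have u0: "0 \<le> u j" for j
    proof (cases "k < j")
      case True
      then show ?thesis
        using k(2)[of j] by (simp add: u_def)
    next
      case False
      then have "t \<le> turn_time e j"
        unfolding t_def by (intro turn_time_antimono[OF e]) simp
      then show ?thesis
        by (simp add: u_def le_turn_time)
    qed
    have "0 < u k"
      using k(1) p_pos[of k] by (simp add: u_def t_def turn_time_def)
    define L :: "real \<times> real \<Rightarrow> real" where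
      "L v = - (real_of_int (a * b) + 4) * fst v - 4 * real_of_int a * snd v" for v
    have L_sum: "L (\<Sum>j\<in>{lo..<hi}. u j *\<^sub>R root_at j) = (\<Sum>j\<in>{lo..<hi}. u j * L (root_at j))"
      unfolding L_def by (simp add: fst_sum snd_sum sum_distrib_left sum_subtractf sum.distrib algebra_simps)
    have L_pos: "0 < L (root_at j)" for j
    proof -
      have "L (root_at j) = real_of_int (level (simple_root a b (letter j)))"
        by (cases "letter j") (simp_all add: L_def level_def root_at_def)
      then show ?thesis
        using level_simple by simp
    qed
    have "0 < u k * L (root_at k)"
      using \<open>0 < u k\<close> L_pos by simp
    also have "\<dots> \<le> (\<Sum>j\<in>{lo..<hi}. u j * L (root_at j))"
      using u0 L_pos k_in by (intro member_le_sum) (auto simp: less_imp_le)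
    finally show False
      using sum0 L_sum by (simp add: L_def)
  qed
  obtain N where N: "\<And>n. N \<le> n \<Longrightarrow> d n = e n"
  proof -
    obtain N1 N2 where "\<forall>n\<ge>N1. d n = 0" "\<forall>n\<ge>N2. e n = 0"
      using d e by (auto simp: turning_sequence_def)
    then show ?thesis
      using that[of "max N1 N2"] by simp
  qed
  obtain m where m: "d m \<noteq> e m"
    using ne by blast
  define i where "i = (LEAST i. d (N - int i) \<noteq> e (N - int i))"
  define k where "k = N - int i"
  have "d (N - int (nat (N - m))) \<noteq> e (N - int (nat (N - m)))"
    using m N[of m] by (cases "N \<le> m") auto
  then have k: "d k \<noteq> e k"
    unfolding k_def i_def by (rule LeastI[where P = "\<lambda>i. d (N - int i) \<noteq> e (N - int i)"])
  have above: "d l = e l" if "k < l" for l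
  proof (cases "N \<le> l")
    case False
    then have "nat (N - l) < i"
      using that by (simp add: k_def)
    then have "\<not> d (N - int (nat (N - l))) \<noteq> e (N - int (nat (N - l)))"
      unfolding i_def by (rule not_less_Least)
    then show ?thesis
      using False by simp
  qed (rule N)
  show False
  proof (cases "d k < e k")
    case True
    then show ?thesis
      using main[OF d e eq] above by blast
  next
    case False
    then have "e k < d k"
      using k by simp
    then show ?thesis
      using main[OF e d eq[symmetric]] above by metis
  qed
qed

end

section \<open>Lakshmibai--Seshadri paths are the paths of turning sequences\<close>

lemma hd_last_nth:
  assumes "length xs = Suc n"
  shows "hd xs = xs ! 0" "last xs = xs ! n"
proof -
  have "xs \<noteq> []"
    using assms by auto
  then show "hd xs = xs ! 0" "last xs = xs ! n"
    using assms by (auto simp: hd_conv_nth last_conv_nth)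
qed

text \<open>
  The length of the part of the \<open>k\<close>-th segment before \<open>t\<close> is \<open>min t \<sigma>\<^sub>k\<^sub>+\<^sub>1 - min t \<sigma>\<^sub>k\<close>, which avoids
  the search for the segment that contains \<open>t\<close>.
\<close>

lemma path_map_formula:
  assumes len: "length ss = Suc (length ms)" and ne: "ms \<noteq> []" and ends: "hd ss = 0" "last ss = 1"
    and sorted: "sorted_wrt (<) ss" and t: "t \<in> {0..1}"
  shows "path_map (ms, ss) t =
    (\<Sum>k<length ms. (min t (of_rat (ss ! Suc k)) - min t (of_rat (ss ! k))) *\<^sub>R real_weight (ms ! k))"
proof -
  define u where "u = length ms"
  define \<sigma> where "\<sigma> k = (of_rat (ss ! k) :: real)" for k
  define w where "w k = (min t (\<sigma> (Suc k)) - min t (\<sigma> k)) *\<^sub>R real_weight (ms ! k)" for k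
  have \<sigma>0: "\<sigma> 0 = 0" and \<sigma>u: "\<sigma> u = 1"
    using ends hd_last_nth[OF len] by (auto simp: \<sigma>_def u_def)
  have mono: "\<sigma> k \<le> \<sigma> l" if "k \<le> l" "l \<le> u" for k l
    using sorted that len by (cases "k = l") (auto simp: \<sigma>_def u_def sorted_wrt_iff_nth_less of_rat_less_eq less_imp_le)
  define j where "j = (LEAST j. t \<le> \<sigma> (Suc j))"
  have ex: "t \<le> \<sigma> (Suc (u - 1))"
    using t ne \<sigma>u by (simp add: u_def)
  have j: "t \<le> \<sigma> (Suc j)"
    unfolding j_def using ex by (rule LeastI)
  have ju: "j < u"
    using Least_le[of "\<lambda>j. t \<le> \<sigma> (Suc j)" "u - 1", OF ex] ne by (simp add: j_def u_def) (metis Suc_le_eq Suc_pred length_greater_0_conv less_eq_Suc_le not_less_eq_eq)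
  have before: "\<sigma> (Suc k) < t" if "k < j" for k
    using not_less_Least[of k "\<lambda>j. t \<le> \<sigma> (Suc j)"] that by (simp add: j_def)
  have \<sigma>j: "\<sigma> j \<le> t"
  proof (cases j)
    case 0
    then show ?thesis using \<sigma>0 t by simp
  next
    case (Suc i)
    then show ?thesis using before[of i] by simp
  qed
  have split: "{..<u} = {..<j} \<union> insert j {Suc j..<u}"
    using ju by auto
  have "(\<Sum>k<u. w k) = (\<Sum>k<j. w k) + (\<Sum>k\<in>insert j {Suc j..<u}. w k)"
    unfolding split by (rule sum.union_disjoint) auto
  also have "(\<Sum>k\<in>insert j {Suc j..<u}. w k) = w j + (\<Sum>k\<in>{Suc j..<u}. w k)"
    by simp
  also have "(\<Sum>k<j. w k) = (\<Sum>k<j. (\<sigma> (Suc k) - \<sigma> k) *\<^sub>R real_weight (ms ! k))"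
  proof (intro sum.cong refl)
    fix k assume "k \<in> {..<j}"
    then have "\<sigma> (Suc k) < t" "\<sigma> k \<le> \<sigma> (Suc k)"
      using before[of k] mono[of k "Suc k"] ju by auto
    then show "w k = (\<sigma> (Suc k) - \<sigma> k) *\<^sub>R real_weight (ms ! k)"
      by (simp add: w_def)
  qed
  also have "w j = (t - \<sigma> j) *\<^sub>R real_weight (ms ! j)"
    using j \<sigma>j by (simp add: w_def)
  also have "(\<Sum>k\<in>{Suc j..<u}. w k) = 0"
  proof (intro sum.neutral ballI)
    fix k assume "k \<in> {Suc j..<u}"
    then have "t \<le> \<sigma> k" "t \<le> \<sigma> (Suc k)"
      using j mono[of "Suc j" k] mono[of "Suc j" "Suc k"] by auto
    then show "w k = 0"
      by (simp add: w_def)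
  qed
  finally have "(\<Sum>k<u. w k) = (\<Sum>k<j. (\<sigma> (Suc k) - \<sigma> k) *\<^sub>R real_weight (ms ! k)) + (t - \<sigma> j) *\<^sub>R real_weight (ms ! j)"
    by simp
  moreover have "path_map (ms, ss) t =
      (\<Sum>k<j. (\<sigma> (Suc k) - \<sigma> k) *\<^sub>R real_weight (ms ! k)) + (t - \<sigma> j) *\<^sub>R real_weight (ms ! j)"
    using t by (simp add: path_map_def Let_def \<sigma>_def j_def of_rat_diff)
  ultimately show ?thesis
    by (simp add: w_def \<sigma>_def u_def)
qed

lemma threshold_exists:
  fixes P :: "int \<Rightarrow> bool"
  assumes down: "\<And>i j. i \<le> j \<Longrightarrow> P j \<Longrightarrow> P i" and "P lo" "\<not> P hi"
  obtains n where "\<And>j. j < n \<longleftrightarrow> P j"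
proof -
  define i where "i = (LEAST i. \<not> P (lo + int i))"
  have "lo \<le> hi"
    using assms by (meson linear)
  then have "\<not> P (lo + int (nat (hi - lo)))"
    using assms by simp
  then have i: "\<not> P (lo + int i)"
    unfolding i_def by (rule LeastI)
  have "P j" if "j < lo + int i" for j
  proof (cases "j \<le> lo")
    case False
    then have "nat (j - lo) < i"
      using that by simp
    from not_less_Least[OF this[unfolded i_def]] False show ?thesis
      by simp
  qed (use down assms in blast)
  moreover have "\<not> P j" if "lo + int i \<le> j" for j
    using down[OF that] i by blast
  ultimately show ?thesis
    using that[of "lo + int i"] by (meson not_le)
qed

context weight_chain
begin

text \<open>
  \<open>K j\<close> counts the segments whose index exceeds \<open>j\<close>, so that \<open>ss ! K j\<close> is the time at which the path
  passes \<open>j\<close>. Write each weight as the top weight plus the differences of neighbouring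
  weights above it and exchange the sums over segments and over indices; the sum over segments then telescopes.
\<close>

lemma path_map_eq_turning_path:
  fixes ns :: "int list" and ss :: "rat list"
  assumes len: "length ss = Suc (length ns)" and ne: "ns \<noteq> []" and ends: "hd ss = 0" "last ss = 1"
    and sorted: "sorted_wrt (<) ss"
    and K: "\<And>j. K j \<le> length ns" "\<And>j k. k < length ns \<Longrightarrow> j < ns ! k \<longleftrightarrow> k < K j"
    and d: "\<And>j. of_int (d j) = of_int (p j) * ss ! K j"
  shows "path_map (map (chain_weight p) ns, ss) = turning_path d"
proof -
  define u where "u = length ns"
  define \<sigma> where "\<sigma> k = (of_rat (ss ! k) :: real)" for k
  have \<sigma>0: "\<sigma> 0 = 0" and \<sigma>u: "\<sigma> u = 1"
    using ends hd_last_nth[OF len] by (auto simp: \<sigma>_def u_def)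
  have d_real: "real_of_int (d j) = real_of_int (p j) * \<sigma> (K j)" for j
    using arg_cong[OF d[of j], of "of_rat :: rat \<Rightarrow> real"] by (simp add: \<sigma>_def of_rat_mult)
  define lo where "lo = Min (set ns)"
  define hi where "hi = Max (set ns)"
  have range: "lo \<le> ns ! k" "ns ! k \<le> hi" if "k < u" for k
    using that by (auto simp: lo_def hi_def u_def)
  have bd: "bounds p d lo hi"
    unfolding bounds_def
  proof (intro conjI allI impI)
    show "lo \<le> hi"
      using ne range[of 0] by (simp add: u_def)
    fix n
    show "d n = 0" if "hi \<le> n"
    proof -
      have "K n = 0"
        using K(2)[of 0 n] range[of 0] ne that by (auto simp: u_def)
      then show ?thesis
        using d_real[of n] \<sigma>0 by simp
    qed
    show "d n = p n" if "n < lo"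
    proof -
      have "\<not> K n < u"
        using K(2)[of "K n" n] range[of "K n"] that by (auto simp: u_def)
      then have "K n = u"
        using K(1)[of n] by (simp add: u_def)
      then show ?thesis
        using d_real[of n] \<sigma>u by simp
    qed
  qed
  have "path_map (map (chain_weight p) ns, ss) t = trace lo hi d t" if t: "t \<in> {0..1}" for t
  proof -
    define w where "w k = min t (\<sigma> (Suc k)) - min t (\<sigma> k)" for k
    have tele: "(\<Sum>k\<in>{m..<u}. w k) = t - min t (\<sigma> m)" if "m \<le> u" for m
      using sum_Suc_diff'[OF that, of "\<lambda>k. min t (\<sigma> k)"] t \<sigma>u by (simp add: w_def)
    have weight: "real_weight (chain_weight p (ns ! k)) = real_weight (chain_weight p hi) +
        (\<Sum>j\<in>{lo..<hi}. if K j \<le> k then real_of_int (p j) *\<^sub>R root_at j else 0)" if "k < u" for k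
    proof -
      have "(\<Sum>j\<in>{lo..<hi}. if K j \<le> k then real_of_int (p j) *\<^sub>R root_at j else 0) =
          (\<Sum>j\<in>{ns ! k..<hi}. real_of_int (p j) *\<^sub>R root_at j)"
      proof (rule sum.mono_neutral_cong_right)
        show "{ns ! k..<hi} \<subseteq> {lo..<hi}"
          using range[OF that] by auto
      qed (use K(2)[of k] that in \<open>auto simp: u_def not_le[symmetric]\<close>)
      then show ?thesis
        using real_chain_weight_telescope[of "ns ! k" hi] range[OF that] by simp
    qed
    have coeff: "(\<Sum>k<u. if K j \<le> k then w k else 0) * p j = max 0 (real_of_int (p j) * t - real_of_int (d j))" for j
    proof -
      have Kj: "K j \<le> u"
        using K(1) by (simp add: u_def)
      have "(\<Sum>k<u. if K j \<le> k then w k else 0) = (\<Sum>k\<in>{K j..<u}. w k)"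
        by (rule sum.mono_neutral_cong_right) auto
      also have "\<dots> = max 0 (t - \<sigma> (K j))"
        by (simp add: tele[OF Kj] max_def min_def)
      finally show ?thesis
        using p_pos[of j] by (simp add: d_real max_def algebra_simps mult_le_cancel_left)
    qed
    have "path_map (map (chain_weight p) ns, ss) t = (\<Sum>k<u. w k *\<^sub>R real_weight (chain_weight p (ns ! k)))"
      using path_map_formula[of ss "map (chain_weight p) ns" t] len ne ends sorted t
      by (simp add: u_def w_def \<sigma>_def)
    also have "\<dots> = (\<Sum>k<u. w k *\<^sub>R real_weight (chain_weight p hi) +
        (\<Sum>j\<in>{lo..<hi}. ((if K j \<le> k then w k else 0) * p j) *\<^sub>R root_at j))"
    proof (rule sum.cong)
      fix k assume "k \<in> {..<u}"
      then have "k < u" by simp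
      have "w k *\<^sub>R (\<Sum>j\<in>{lo..<hi}. if K j \<le> k then real_of_int (p j) *\<^sub>R root_at j else 0) =
          (\<Sum>j\<in>{lo..<hi}. ((if K j \<le> k then w k else 0) * p j) *\<^sub>R root_at j)"
        unfolding scaleR_sum_right by (intro sum.cong) auto
      then show "w k *\<^sub>R real_weight (chain_weight p (ns ! k)) = w k *\<^sub>R real_weight (chain_weight p hi) +
        (\<Sum>j\<in>{lo..<hi}. ((if K j \<le> k then w k else 0) * p j) *\<^sub>R root_at j)"
        by (simp add: weight[OF \<open>k < u\<close>] scaleR_add_right)
    qed simp
    also have "\<dots> = (\<Sum>k<u. w k) *\<^sub>R real_weight (chain_weight p hi) +
        (\<Sum>j\<in>{lo..<hi}. ((\<Sum>k<u. if K j \<le> k then w k else 0) * p j) *\<^sub>R root_at j)"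
      unfolding sum.distrib by (subst sum.swap) (simp add: scaleR_sum_left sum_distrib_right)
    also have "(\<Sum>k<u. w k) = t"
      using tele[of 0] t \<sigma>0 by (simp add: lessThan_atLeast0)
    finally show ?thesis
      unfolding trace_def coeff .
  qed
  then show ?thesis
    unfolding turning_path_eq[OF bd] by (auto simp: path_map_def fun_eq_iff)
qed

text \<open>
  If the index \<open>j\<close> is passed at a time \<open>\<sigma>\<^sub>k\<close> strictly between \<open>0\<close> and \<open>1\<close>, then \<open>\<sigma>\<^sub>k p j\<close> is an integer
  because of the \<open>\<sigma>\<^sub>k\<close>-chain.
\<close>

lemma LS_path_turning:
  assumes "is_LS_path a b lam (ms, ss)"
  obtains d where "turning_sequence p d" "path_map (ms, ss) = turning_path d"
proof -
  have LS: "ms \<noteq> []" "length ss = Suc (length ms)" "set ms \<subseteq> range (chain_weight p)"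
    "hd ss = 0" "last ss = 1" "sorted_wrt (<) ss"
    and adj: "\<And>k. Suc k < length ms \<Longrightarrow> orbit_gt a b lam (ms ! k) (ms ! Suc k) \<and>
        sigma_chain a b lam (ss ! Suc k) (ms ! k) (ms ! Suc k)"
    using assms orbit by (auto simp: is_LS_path_def)
  have "\<forall>m\<in>set ms. \<exists>n. m = chain_weight p n"
    using LS(3) by blast
  then obtain ns where ns: "ms = map (chain_weight p) ns"
    unfolding ex_map_conv[symmetric] by blast
  define u where "u = length ns"
  have u: "length ms = u" "length ss = Suc u" "0 < u"
    using LS ns by (auto simp: u_def)
  have dec: "ns ! l \<le> ns ! k" if "k \<le> l" "l < u" for k l
    using that
  proof (induction l rule: dec_induct)
    case (step n)
    then show ?case
      using adj[of n] u by (simp add: ns u_def orbit_gt_chain)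
  qed simp
  have ss_less: "ss ! k < ss ! l \<longleftrightarrow> k < l" if "k \<le> u" "l \<le> u" for k l
    using LS(6) that u by (auto simp: sorted_wrt_iff_nth_less) (metis le_imp_less_Suc less_asym linorder_neqE_nat)
  have ss0: "ss ! 0 = 0" and ssu: "ss ! u = 1"
    using LS hd_last_nth[OF u(2)] by auto
  define K where "K j = (LEAST k. k = u \<or> ns ! k \<le> j)" for j
  have Ku: "K j \<le> u" for j
    unfolding K_def by (rule Least_le) simp
  have Kiff: "j < ns ! k \<longleftrightarrow> k < K j" if "k < u" for j k
  proof
    assume "k < K j"
    then show "j < ns ! k"
      using not_less_Least[of k "\<lambda>k. k = u \<or> ns ! k \<le> j"] by (simp add: K_def)
  next
    assume jk: "j < ns ! k"
    have "K j = u \<or> ns ! K j \<le> j"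
      unfolding K_def by (rule LeastI[of _ u]) simp
    then show "k < K j"
      using dec[of "K j" k] jk that by (cases "k < K j") auto
  qed
  have "of_int (p j) * ss ! K j \<in> \<int>" for j
  proof -
    consider "K j = 0" | "K j = u" | i where "K j = Suc i" "Suc i < u"
      using Ku[of j] by (cases "K j") (auto simp: le_less)
    then show ?thesis
    proof cases
      case 3
      then have "j \<in> {ns ! Suc i..<ns ! i}"
        using Kiff[of "Suc i" j] Kiff[of i j] by auto
      moreover have "0 < ss ! Suc i"
        using ss_less[of 0 "Suc i"] ss0 3 by simp
      ultimately show ?thesis
        using adj[of i] 3 u by (simp add: ns u_def sigma_chain_iff mult.commute)
    qed (use ss0 ssu in auto)
  qed
  then have "\<forall>j. \<exists>x. of_int x = of_int (p j) * ss ! K j"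
    by (metis Ints_cases)
  then obtain d where d: "\<And>j. of_int (d j) = of_int (p j) * ss ! K j"
    by metis
  have ss_le: "ss ! k \<le> ss ! l" if "k \<le> l" "l \<le> u" for k l
    using ss_less[of k l] that by (cases "k = l") auto
  have "turning_sequence p d"
    unfolding turning_sequence_def
  proof (intro conjI allI)
    fix n
    have r: "0 \<le> ss ! K n" "ss ! K n \<le> 1"
      using ss_le[of 0 "K n"] ss_le[of "K n" u] Ku[of n] ss0 ssu by auto
    then have "0 \<le> (of_int (d n) :: rat)" "(of_int (d n) :: rat) \<le> of_int (p n)"
      unfolding d using p_pos[of n] by (auto simp: mult_left_le)
    then show "0 \<le> d n" "d n \<le> p n"
      by simp_all
    have "K (n + 1) \<le> K n"
      using Kiff[of "K n" n] Kiff[of "K n" "n + 1"] Ku[of n] Ku[of "n + 1"] by (cases "K n = u") force+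
    then have "ss ! K (n + 1) \<le> ss ! K n"
      using ss_le Ku by blast
    then have "of_int (p (n + 1)) * ss ! K (n + 1) * of_int (p n) \<le> of_int (p n) * ss ! K n * of_int (p (n + 1))"
      using p_pos[of n] p_pos[of "n + 1"] by (simp add: mult.commute mult.left_commute mult_left_mono)
    then have "(of_int (d (n + 1) * p n) :: rat) \<le> of_int (d n * p (n + 1))"
      by (simp add: d)
    then show "d (n + 1) * p n \<le> d n * p (n + 1)"
      by (simp only: of_int_le_iff)
  next
    show "\<exists>N. \<forall>n\<ge>N. d n = 0"
    proof (intro exI[of _ "ns ! 0"] allI impI)
      fix n assume "ns ! 0 \<le> n"
      then have "K n = 0"
        using Kiff[of 0 n] u by auto
      then show "d n = 0"
        using d[of n] ss0 by simp
    qed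
    show "\<exists>N. \<forall>n\<le>N. d n = p n"
    proof (intro exI[of _ "ns ! (u - 1) - 1"] allI impI)
      fix n assume "n \<le> ns ! (u - 1) - 1"
      then have "K n = u"
        using Kiff[of "u - 1" n] u Ku[of n] by auto
      then show "d n = p n"
        using d[of n] ssu by simp
    qed
  qed
  moreover have "path_map (ms, ss) = turning_path d"
    unfolding ns
    by (rule path_map_eq_turning_path[where K = K])
       (use LS u Ku Kiff d in \<open>auto simp: ns u_def\<close>)
  ultimately show ?thesis
    using that by blast
qed

text \<open>
  The times of the LS path are \<open>0\<close>, \<open>1\<close> and all the values \<open>d j / p j\<close>, in increasing order. The index of
  a segment is the smallest \<open>n\<close> that is not passed after the start of that segment.
\<close>

lemma turning_LS_path:
  assumes d: "turning_sequence p d"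
  shows "turning_path d \<in> LS_paths a b lam"
proof -
  define s :: "int \<Rightarrow> rat" where "s j = of_int (d j) / of_int (p j)" for j
  have dn: "0 \<le> d n" "d n \<le> p n" "d (n + 1) * p n \<le> d n * p (n + 1)" for n
    using d by (auto simp: turning_sequence_def)
  have ds: "of_int (d j) = of_int (p j) * s j" for j
    using p_pos[of j] by (simp add: s_def)
  have s_range: "0 \<le> s j" "s j \<le> 1" for j
    using dn[of j] p_pos[of j] by (auto simp: s_def)
  have anti: "s n \<le> s m" if "m \<le> n" for m n
    using that
  proof (induction n rule: int_ge_induct)
    case (step n)
    have "(of_int (d (n + 1) * p n) :: rat) \<le> of_int (d n * p (n + 1))"
      using dn(3)[of n] by (simp only: of_int_le_iff)
    then have "s (n + 1) \<le> s n"
      using p_pos[of n] p_pos[of "n + 1"] by (simp add: s_def field_simps)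
    then show ?case
      using step by simp
  qed simp
  obtain lo hi where bd: "bounds p d lo hi"
    using turning_sequence_bounds[OF d] .
  have low: "s j = 1" if "j < lo" for j
    using bd that p_pos[of j] by (simp add: bounds_def s_def)
  have high: "s j = 0" if "hi \<le> j" for j
    using bd that by (simp add: bounds_def s_def)
  define S where "S = insert 0 (insert 1 (range s))"
  have "s j \<in> insert 0 (insert 1 (s ` {lo..<hi}))" for j
    using low[of j] high[of j] by (cases "j < lo"; cases "hi \<le> j") auto
  then have "range s \<subseteq> insert 0 (insert 1 (s ` {lo..<hi}))"
    by blast
  then have fin: "finite S"
    unfolding S_def by (meson finite.insertI finite_imageI finite_atLeastLessThan_int finite_subset)
  define ss where "ss = sorted_list_of_set S"
  have ss: "set ss = S" "sorted_wrt (<) ss" "distinct ss" "sorted ss"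
    using fin by (auto simp: ss_def)
  have "card S \<ge> card {0, 1 :: rat}"
    using fin by (intro card_mono) (auto simp: S_def)
  then have len2: "2 \<le> length ss"
    using fin by (simp add: ss_def)
  define u where "u = length ss - 1"
  have u: "length ss = Suc u" "0 < u"
    using len2 by (auto simp: u_def)
  have ss_less: "ss ! k < ss ! l \<longleftrightarrow> k < l" if "k \<le> u" "l \<le> u" for k l
    using ss(2) that u by (auto simp: sorted_wrt_iff_nth_less) (metis le_imp_less_Suc less_asym linorder_neqE_nat)
  have nth_in: "ss ! k \<in> S" if "k \<le> u" for k
    using that u ss(1) by (metis le_imp_less_Suc nth_mem)
  have S_range: "0 \<le> x" "x \<le> 1" if "x \<in> S" for x
    using that s_range by (auto simp: S_def)
  have index: "\<exists>k\<le>u. ss ! k = x" if "x \<in> S" for x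
    using that ss(1) u by (metis in_set_conv_nth less_Suc_eq_le)
  have ss0: "ss ! 0 = 0"
  proof -
    obtain k where "k \<le> u" "ss ! k = 0"
      using index[of 0] by (auto simp: S_def)
    then show ?thesis
      using ss_less[of 0 k] S_range(1)[OF nth_in[of 0]] by (cases "k = 0") auto
  qed
  have ssu: "ss ! u = 1"
  proof -
    obtain k where "k \<le> u" "ss ! k = 1"
      using index[of 1] by (auto simp: S_def)
    then show ?thesis
      using ss_less[of k u] S_range(2)[OF nth_in[of u]] by (cases "k = u") auto
  qed
  have "\<forall>k. \<exists>n. k < u \<longrightarrow> (\<forall>j. j < n \<longleftrightarrow> ss ! k < s j)"
  proof
    fix k
    show "\<exists>n. k < u \<longrightarrow> (\<forall>j. j < n \<longleftrightarrow> ss ! k < s j)"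
    proof (cases "k < u")
      case True
      have "ss ! k < s (lo - 1)" "\<not> ss ! k < s hi"
        using ss_less[of k u] ssu low[of "lo - 1"] high[of hi] S_range(1)[OF nth_in[of k]] True by auto
      moreover have "ss ! k < s i" if "i \<le> j" "ss ! k < s j" for i j
        using anti[OF that(1)] that(2) by simp
      ultimately obtain n where "\<And>j. j < n \<longleftrightarrow> ss ! k < s j"
        using threshold_exists[of "\<lambda>j. ss ! k < s j" "lo - 1" hi] by blast
      then show ?thesis
        by blast
    qed simp
  qed
  then obtain N where N: "\<And>k j. k < u \<Longrightarrow> j < N k \<longleftrightarrow> ss ! k < s j"
    by metis
  have "\<forall>j. \<exists>k\<le>u. ss ! k = s j"
    using index by (simp add: S_def)
  then obtain K where K: "\<And>j. K j \<le> u" "\<And>j. ss ! K j = s j"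
    by metis
  define ns where "ns = map N [0..<u]"
  have ns: "length ns = u" "\<And>k. k < u \<Longrightarrow> ns ! k = N k"
    by (auto simp: ns_def)
  have NK: "j < N k \<longleftrightarrow> k < K j" if "k < u" for j k
    using N[OF that] ss_less[of k "K j"] K[of j] that by simp
  have map_eq: "path_map (map (chain_weight p) ns, ss) = turning_path d"
  proof (rule path_map_eq_turning_path[where K = K])
    show "hd ss = 0" "last ss = 1"
      using ss0 ssu hd_last_nth[OF u(1)] by auto
    show "ns \<noteq> []"
      using ns u by auto
  qed (use u ns K NK ds ss in auto)
  have "is_LS_path a b lam (map (chain_weight p) ns, ss)"
    unfolding is_LS_path_def prod.case
  proof (intro conjI allI impI)
    show "map (chain_weight p) ns \<noteq> []" "length ss = Suc (length (map (chain_weight p) ns))"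
      using ns u by auto
    show "set (map (chain_weight p) ns) \<subseteq> weyl_orbit a b lam"
      using orbit by auto
    show "hd ss = 0" "last ss = 1"
      using ss0 ssu hd_last_nth[OF u(1)] by auto
    show "sorted_wrt (<) ss"
      by (rule ss)
  next
    fix k assume "Suc k < length (map (chain_weight p) ns)"
    then have k: "Suc k < u"
      by (simp add: ns)
    have "ss ! Suc k \<noteq> 0" "ss ! Suc k \<noteq> 1"
      using ss_less[of 0 "Suc k"] ss_less[of "Suc k" u] k ss0 ssu by auto
    then obtain i where i: "s i = ss ! Suc k"
      using nth_in[of "Suc k"] k by (auto simp: S_def)
    have "ss ! k < ss ! Suc k"
      using ss_less[of k "Suc k"] k by simp
    then have "N (Suc k) \<le> i" "i < N k"
      using N[of "Suc k" i] N[of k i] i k by auto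
    then have drop: "N (Suc k) < N k"
      by simp
    show "orbit_gt a b lam (map (chain_weight p) ns ! k) (map (chain_weight p) ns ! Suc k)"
      using drop k ns by (simp add: orbit_gt_chain)
    have "ss ! Suc k * of_int (p j) \<in> \<int>" if "j \<in> {N (Suc k)..<N k}" for j
    proof -
      have "k < K j" "\<not> Suc k < K j"
        using that NK[of k j] NK[of "Suc k" j] k by auto
      then have "K j = Suc k"
        by simp
      then have "ss ! Suc k * of_int (p j) = of_int (d j)"
        using K(2)[of j] ds[of j] by (simp add: mult.commute)
      then show ?thesis
        by simp
    qed
    moreover have "0 < ss ! Suc k"
      using ss_less[of 0 "Suc k"] k ss0 by simp
    ultimately show "sigma_chain a b lam (ss ! Suc k) (map (chain_weight p) ns ! k) (map (chain_weight p) ns ! Suc k)"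
      using drop k ns by (simp add: sigma_chain_iff)
  qed
  then show ?thesis
    unfolding LS_paths_def map_eq[symmetric] by blast
qed

lemma LS_paths_eq: "LS_paths a b lam = turning_path ` {d. turning_sequence p d}"
proof
  show "LS_paths a b lam \<subseteq> turning_path ` {d. turning_sequence p d}"
  proof
    fix \<pi> assume "\<pi> \<in> LS_paths a b lam"
    then obtain ms ss where "is_LS_path a b lam (ms, ss)" "\<pi> = path_map (ms, ss)"
      by (auto simp: LS_paths_def)
    then show "\<pi> \<in> turning_path ` {d. turning_sequence p d}"
      using LS_path_turning by blast
  qed
  show "turning_path ` {d. turning_sequence p d} \<subseteq> LS_paths a b lam"
    using turning_LS_path by blast
qed

end

section \<open>The crystal graph\<close>

context weight_chain
begin

abbreviation step where "step \<equiv> crystal_step (coef a b) p"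

abbreviation sym_graph where "sym_graph \<equiv> with_proj (mk_symmetric (crystal_graph a b lam))"

lemma sym_graph_verts: "verts sym_graph = turning_path ` {d. turning_sequence p d}"
  by (simp add: crystal_graph_def LS_paths_eq)

lemma sym_graph_wf: "wf_digraph sym_graph"
proof -
  have "wf_digraph (crystal_graph a b lam)"
    by unfold_locales (auto simp: crystal_graph_def)
  then interpret pair_wf_digraph "mk_symmetric (crystal_graph a b lam)"
    by (rule wf_digraph.wellformed_mk_symmetric)
  show ?thesis
    by unfold_locales
qed

lemma crystal_graph_arc_iff:
  "(\<exists>i. (\<pi>, i, \<pi>') \<in> arcs (crystal_graph a b lam)) \<longleftrightarrow>
    (\<exists>d d'. step d d' \<and> \<pi> = turning_path d \<and> \<pi>' = turning_path d')"
proof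
  assume "\<exists>i. (\<pi>, i, \<pi>') \<in> arcs (crystal_graph a b lam)"
  then obtain i where "\<pi> \<in> LS_paths a b lam" "f_op a b i \<pi> = Some \<pi>'"
    by (auto simp: crystal_graph_def)
  then obtain d where d: "turning_sequence p d" "\<pi> = turning_path d" "f_op a b i (turning_path d) = Some \<pi>'"
    by (auto simp: LS_paths_eq)
  obtain j where j: "f_acts_at (coef a b) d j" "\<pi>' = turning_path (d(j := d j + 1))"
    using f_op_Some[OF d(1,3)] by blast
  then have "step d (d(j := d j + 1))"
    using d(1) turning_sequence_f[OF p p_pos d(1) j(1)] by (auto simp: crystal_step_def)
  then show "\<exists>d d'. step d d' \<and> \<pi> = turning_path d \<and> \<pi>' = turning_path d'"
    using d(2) j(2) by blast
next
  assume "\<exists>d d'. step d d' \<and> \<pi> = turning_path d \<and> \<pi>' = turning_path d'"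
  then obtain d j where d: "turning_sequence p d" "turning_sequence p (d(j := d j + 1))"
    and j: "f_acts_at (coef a b) d j" "\<pi> = turning_path d" "\<pi>' = turning_path (d(j := d j + 1))"
    by (auto simp: crystal_step_def)
  then have "(\<pi>, letter j, \<pi>') \<in> arcs (crystal_graph a b lam)"
    using f_op_acts[OF d(1) j(1)] by (auto simp: crystal_graph_def LS_paths_eq)
  then show "\<exists>i. (\<pi>, i, \<pi>') \<in> arcs (crystal_graph a b lam)" ..
qed

lemma sym_graph_adjacent_iff:
  "\<pi> \<rightarrow>\<^bsub>sym_graph\<^esub> \<pi>' \<longleftrightarrow>
    (\<exists>d d'. (step d d' \<or> step d' d) \<and> \<pi> = turning_path d \<and> \<pi>' = turning_path d')"
proof -
  have "\<pi> \<rightarrow>\<^bsub>sym_graph\<^esub> \<pi>' \<longleftrightarrow> (\<exists>i. (\<pi>, i, \<pi>') \<in> arcs (crystal_graph a b lam)) \<or>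
      (\<exists>i. (\<pi>', i, \<pi>) \<in> arcs (crystal_graph a b lam))"
  proof -
    have "\<pi> \<rightarrow>\<^bsub>sym_graph\<^esub> \<pi>' \<longleftrightarrow> (\<pi>, \<pi>') \<in> parcs (mk_symmetric (crystal_graph a b lam))"
      by simp
    also have "\<dots> \<longleftrightarrow> (\<exists>e\<in>arcs (crystal_graph a b lam).
        (\<pi>, \<pi>') \<in> {(fst e, snd (snd e)), (snd (snd e), fst e)})"
      by (auto simp: parcs_mk_symmetric crystal_graph_def)
    finally show ?thesis
      by fastforce
  qed
  then show ?thesis
    unfolding crystal_graph_arc_iff by blast
qed

lemma reachable_if_equivclp:
  assumes "equivclp step d e" "turning_sequence p d"
  shows "turning_path d \<rightarrow>\<^sup>*\<^bsub>sym_graph\<^esub> turning_path e"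
  using assms(1)
proof (induction rule: equivclp_induct)
  case base
  show ?case
    using assms(2) sym_graph_verts by (intro wf_digraph.reachable_refl[OF sym_graph_wf]) blast
next
  case (step y z)
  then have "turning_path y \<rightarrow>\<^bsub>sym_graph\<^esub> turning_path z"
    unfolding sym_graph_adjacent_iff by blast
  then show ?case
    using step.IH wf_digraph.reachable_adj_trans[OF sym_graph_wf] by blast
qed

lemma crystal_connected:
  assumes "p m = 1"
  shows "Digraph_Component.connected (crystal_graph a b lam)"
proof -
  have "strongly_connected sym_graph"
  proof (rule strongly_connectedI)
    show "verts sym_graph \<noteq> {}"
      unfolding sym_graph_verts using turning_sequence_straight[of p m, OF p_pos] by blast
    fix \<pi> \<pi>' assume "\<pi> \<in> verts sym_graph" "\<pi>' \<in> verts sym_graph"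
    then obtain d d' where d: "turning_sequence p d" "\<pi> = turning_path d"
      and d': "turning_sequence p d'" "\<pi>' = turning_path d'"
      unfolding sym_graph_verts by blast
    have "equivclp step d d'"
      using crystal_steps_connected[OF p p_pos assms d(1)] crystal_steps_connected[OF p p_pos assms d'(1)]
      by (meson equivclp_sym equivclp_trans)
    then show "\<pi> \<rightarrow>\<^sup>*\<^bsub>sym_graph\<^esub> \<pi>'"
      unfolding d(2) d'(2) using d(1) by (rule reachable_if_equivclp)
  qed
  then show ?thesis
    by (simp only: Digraph_Component.connected_def)
qed

text \<open>
  A path determines its sequence, so the property of having a locked window passes along the arcs of
  the graph in both directions.
\<close>

lemma reachable_locked:
  assumes c: "solution (coef a b) c" "\<And>n. 0 < c n" and c': "solution (coef a b) c'" "\<And>n. 0 < c' n"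
    and pc: "\<And>n. p n = c n + c' n" and r: "0 < r"
    and reach: "turning_path d \<rightarrow>\<^sup>*\<^bsub>sym_graph\<^esub> turning_path e"
    and d: "turning_sequence p d" and e: "turning_sequence p e" and lock: "locked c c' r d"
  shows "locked c c' r e"
proof -
  define Q where "Q \<pi> \<longleftrightarrow> (\<exists>x. turning_sequence p x \<and> \<pi> = turning_path x \<and> locked c c' r x)" for \<pi>
  have "Q (turning_path e)"
    using reach
  proof (induction rule: wf_digraph.reachable_induct[OF sym_graph_wf, consumes 1, case_names base step])
    case base
    show ?case
      using d lock by (auto simp: Q_def)
  next
    case (step \<pi> \<pi>')
    obtain x where x: "turning_sequence p x" "\<pi> = turning_path x" "locked c c' r x"
      using step.IH by (auto simp: Q_def)
    obtain y z where yz: "step y z \<or> step z y" "\<pi> = turning_path y" "\<pi>' = turning_path z"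
      using step.hyps(2) unfolding sym_graph_adjacent_iff by blast
    have ty: "turning_sequence p y" "turning_sequence p z"
      using yz(1) by (auto simp: crystal_step_def)
    have "y = x"
      using turning_path_inj[OF ty(1) x(1)] yz(2) x(2) by simp
    then have "locked c c' r z"
      using locked_crystal_step[OF c c' p pc r] yz(1) x(3) by blast
    then show ?case
      using ty yz(3) by (auto simp: Q_def)
  qed
  then show ?thesis
    using turning_path_inj[OF _ e] by (auto simp: Q_def)
qed

text \<open>
  The paths of the window sequences lie in pairwise different components: a locked window of length
  \<open>2r'\<close> would have to be found in a sequence that has only one of length \<open>2r < 2r'\<close>.
\<close>

lemma crystal_infinitely_many_components:
  assumes p2: "\<And>n. 2 \<le> p n"
  shows "infinite (connected_components (crystal_graph a b lam))"
    and "\<not> Digraph_Component.connected (crystal_graph a b lam)"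
proof -
  have coef2: "2 \<le> coef a b n" for n
    using a b by (simp add: coef_def)
  obtain c c' where c: "solution (coef a b) c" "\<And>n. 0 < c n" and c': "solution (coef a b) c'" "\<And>n. 0 < c' n"
    and pc: "\<And>n. p n = c n + c' n" and cp: "\<And>n. c (n + 1) * p n \<le> c n * p (n + 1)"
    using dominating_splitting[OF p coef2 p2] by metis
  define w where "w r = window_sequence c p r" for r
  have w: "turning_sequence p (w r)" for r
    unfolding w_def using c(2) c'(2) pc cp by (intro turning_sequence_window) (auto simp: less_imp_le)
  have separated: "\<not> turning_path (w r') \<rightarrow>\<^sup>*\<^bsub>sym_graph\<^esub> turning_path (w r)" if "r < r'" for r r'
  proof
    assume "turning_path (w r') \<rightarrow>\<^sup>*\<^bsub>sym_graph\<^esub> turning_path (w r)"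
    then have "locked c c' r' (w r)"
      using reachable_locked[OF c c' pc, of r' "w r'" "w r"] that w locked_window[OF c(2) c'(2) pc]
      by (simp add: w_def)
    then show False
      using not_locked_window[OF c(2) c'(2) pc that] by (simp add: w_def)
  qed
  interpret wf_digraph sym_graph
    by (rule sym_graph_wf)
  define C where "C r = {\<pi>. turning_path (w r) \<rightarrow>\<^sup>*\<^bsub>sym_graph\<^esub> \<pi> \<and> \<pi> \<rightarrow>\<^sup>*\<^bsub>sym_graph\<^esub> turning_path (w r)}" for r
  have w_C: "turning_path (w r) \<in> C r" for r
    unfolding C_def using w sym_graph_verts by blast
  have "C r \<in> sccs_verts" for r
    unfolding in_sccs_verts_conv_reachable
    using w_C[of r] unfolding C_def by (blast intro: reachable_trans)
  then have "range C \<subseteq> connected_components (crystal_graph a b lam)"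
    unfolding connected_components_def by blast
  moreover have "inj C"
  proof (rule linorder_injI)
    fix r r' :: nat assume "r < r'"
    then show "C r \<noteq> C r'"
      using separated w_C[of r] by (auto simp: C_def)
  qed
  then have "infinite (range C)"
    by (rule range_inj_infinite)
  ultimately show "infinite (connected_components (crystal_graph a b lam))"
    using infinite_super by blast
  show "\<not> Digraph_Component.connected (crystal_graph a b lam)"
  proof
    assume "Digraph_Component.connected (crystal_graph a b lam)"
    then have "\<forall>\<pi>\<in>verts sym_graph. \<forall>\<pi>'\<in>verts sym_graph. \<pi> \<rightarrow>\<^sup>*\<^bsub>sym_graph\<^esub> \<pi>'"
      unfolding Digraph_Component.connected_def strongly_connected_def by blast
    then show False
      using separated[of 0 1] w sym_graph_verts by auto
  qed
qed

lemma unit_entry_iff: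
  "(\<exists>k' l'. (k', - l') \<in> weyl_orbit a b lam \<and> (\<bar>k'\<bar> = 1 \<or> \<bar>l'\<bar> = 1)) \<longleftrightarrow> (\<exists>n. p n = 1)"
proof
  assume "\<exists>k' l'. (k', - l') \<in> weyl_orbit a b lam \<and> (\<bar>k'\<bar> = 1 \<or> \<bar>l'\<bar> = 1)"
  then obtain k' l' n where "(k', - l') = chain_weight p n" "\<bar>k'\<bar> = 1 \<or> \<bar>l'\<bar> = 1"
    using orbit by auto
  then have "p n = 1 \<or> p (n - 1) = 1"
    using p_pos[of n] p_pos[of "n - 1"] by (auto simp: chain_weight_def split: if_splits)
  then show "\<exists>n. p n = 1"
    by blast
next
  assume "\<exists>n. p n = 1"
  then obtain n where n: "p n = 1" ..
  define v where "v = chain_weight p n"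
  have "(fst v, - (- snd v)) \<in> weyl_orbit a b lam"
    by (simp add: orbit v_def)
  moreover have "\<bar>fst v\<bar> = 1 \<or> \<bar>- snd v\<bar> = 1"
    using n by (simp add: v_def chain_weight_def)
  ultimately show "\<exists>k' l'. (k', - l') \<in> weyl_orbit a b lam \<and> (\<bar>k'\<bar> = 1 \<or> \<bar>l'\<bar> = 1)"
    by blast
qed

end

theorem theorem1p2:
  fixes a b :: int and lam :: weight
  assumes "a \<ge> 2" and "b \<ge> 2" and "a * b > 4"
    and "weyl_orbit a b lam \<inter> (dominant_weights \<union> uminus ` dominant_weights) = {}"
  shows "(Digraph_Component.connected (crystal_graph a b lam) \<longleftrightarrow>
            (\<exists>k' l'. (k', - l') \<in> weyl_orbit a b lam \<and> (\<bar>k'\<bar> = 1 \<or> \<bar>l'\<bar> = 1)))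
       \<and> (\<not> (\<exists>k' l'. (k', - l') \<in> weyl_orbit a b lam \<and> (\<bar>k'\<bar> = 1 \<or> \<bar>l'\<bar> = 1)) \<longrightarrow>
            infinite (connected_components (crystal_graph a b lam)))"
proof -
  obtain p where p: "solution (coef a b) p" "\<And>n. 0 < p n" "weyl_orbit a b lam = range (chain_weight p)"
    using orbit_is_positive_chain[OF assms(4)] by blast
  interpret weight_chain a b p lam
    using assms p by unfold_locales auto
  show ?thesis
  proof (cases "\<exists>n. p n = 1")
    case True
    then show ?thesis
      using crystal_connected unit_entry_iff by blast
  next
    case False
    have "2 \<le> p n" for n
    proof -
      have "p n \<noteq> 1"
        using False by blast
      then show ?thesis
        using p_pos[of n] by linarith
    qed
    then show ?thesis
      using crystal_infinitely_many_components unit_entry_iff False by blast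
  qed
qed

end
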